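(* For every integer $s \geq 1$ and every integer $t \geq 1$, the linear threshold of $K_{s,t}'$ is at most $\sigma_s = 2 - 1/s$. Moreover, for every integer $s \geq 1$ and every real number $\sigma < \sigma_s$, there exists $t_0$ (depending on $s$ and $\sigma$) such that for all integers $t \geq t_0$, $\sigma$ is strictly less than the linear threshold of $K_{s,t}'$.
   Context: All bipartite graphs come with an ordered bipartition $(\text{left side}, \text{right side})$; we write $G=(U\sqcup V,E)$ with $U$ the left side and $V$ the right side. For bipartite graphs $H=(A\sqcup B, E_H)$ and $G=(U\sqcup V,E)$, a copy of $H$ in $G$ is an injective map sending $A$ into $U$ and $B$ into $V$ that maps edges of $H$ to edges of $G$. The linear threshold of a bipartite graph $H$ is the smallest real number $\sigma$ such that for every $\epsilon>0$ there exists $\delta$ such that every bipartite graph $G=(U\sqcup V,E)$ with $|V|\geq \epsilon|U|^\sigma$ and $|E|\geq \delta|V|$ contains a copy of $H$. The complete bipartite subdivision $K_{s,t}'$ is the bipartite graph with left side $\{u_1,\dots,u_s,v_1,\dots,v_t\}$, right side $\{w_{ij}: 1\le i\le s, 1\le j\le t\}$, and edges $u_iw_{ij}$ and $v_jw_{ij}$ for all $1\leq i\leq s$, $1\leq j\leq t$. *)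

theory Defs
  imports Complex_Main "HOL-Library.Extended_Real"
begin

text \<open>
  An edge is a pair (left endpoint, right endpoint), so the two sides are
  disjoint by construction, whatever the two vertex types are.
\<close>

record ('a, 'b) bigraph =
  left_side :: "'a set"
  right_side :: "'b set"
  edges :: "('a \<times> 'b) set"

definition finite_bigraph :: "('a, 'b) bigraph \<Rightarrow> bool" where
  "finite_bigraph G \<longleftrightarrow> finite (left_side G) \<and> finite (right_side G) \<and>
     edges G \<subseteq> left_side G \<times> right_side G"

text \<open>
  An injective vertex map that respects the sides is a pair of injective maps,
  one for each side.
\<close>

definition is_copy ::
  "('a, 'b) bigraph \<Rightarrow> ('c, 'd) bigraph \<Rightarrow> ('a \<Rightarrow> 'c) \<Rightarrow> ('b \<Rightarrow> 'd) \<Rightarrow> bool" where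
  "is_copy H G f g \<longleftrightarrow>
     inj_on f (left_side H) \<and> f ` left_side H \<subseteq> left_side G \<and>
     inj_on g (right_side H) \<and> g ` right_side H \<subseteq> right_side G \<and>
     (\<forall>(a, b) \<in> edges H. (f a, g b) \<in> edges G)"

definition contains_copy :: "('c, 'd) bigraph \<Rightarrow> ('a, 'b) bigraph \<Rightarrow> bool" where
  "contains_copy G H \<longleftrightarrow> (\<exists>f g. is_copy H G f g)"

text \<open>
  The host graph must have a vertex: the graph without vertices meets both
  size conditions for every \<open>\<delta>\<close> (with \<open>0 powr \<sigma> = 0\<close>) and contains no copy of
  a nonempty graph. If only the left side is empty, then \<open>G\<close> has no edges and
  every positive \<open>\<delta>\<close> excludes it, so the value of \<open>0 powr \<sigma>\<close> is irrelevant.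

  Host graphs have vertices in \<^typ>\<open>nat\<close>; \<open>linearly_forcedD\<close> below extends this to
  finite bipartite graphs over arbitrary types.
\<close>

definition linearly_forced :: "('a, 'b) bigraph \<Rightarrow> real \<Rightarrow> bool" where
  "linearly_forced H \<sigma> \<longleftrightarrow>
     (\<forall>\<epsilon>::real. \<epsilon> > 0 \<longrightarrow> (\<exists>\<delta>::real. \<forall>G :: (nat, nat) bigraph.
        finite_bigraph G \<and> (left_side G \<noteq> {} \<or> right_side G \<noteq> {}) \<and>
        real (card (right_side G)) \<ge> \<epsilon> * real (card (left_side G)) powr \<sigma> \<and>
        real (card (edges G)) \<ge> \<delta> * real (card (right_side G))
        \<longrightarrow> contains_copy G H))"

text \<open>
  The set of exponents is upward closed (\<open>linearly_forced_mono\<close>) and the linear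
  threshold is its smallest element whenever there is one
  (\<open>linear_threshold_eqI\<close>). There need not be one: every real exponent works for
  the path with two left vertices and one right vertex
  (\<open>linear_threshold_subdiv_1_1\<close>). Hence the infimum in the extended reals;
  that an exponent is attained is expressed by \<^const>\<open>linearly_forced\<close>.
\<close>

definition linear_threshold :: "('a, 'b) bigraph \<Rightarrow> ereal" where
  "linear_threshold H = Inf (ereal ` {\<sigma>. linearly_forced H \<sigma>})"

text \<open>The left vertices \<open>u\<^sub>i\<close> and \<open>v\<^sub>j\<close> are \<open>Inl i\<close> and \<open>Inr j\<close>, and \<open>w\<^sub>i\<^sub>j\<close> is \<open>(i, j)\<close>.\<close>

definition subdiv :: "nat \<Rightarrow> nat \<Rightarrow> (nat + nat, nat \<times> nat) bigraph" where
  "subdiv s t = \<lparr>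
     left_side = {1..s} <+> {1..t},
     right_side = {1..s} \<times> {1..t},
     edges = {(Inl i, (i, j)) | i j. i \<in> {1..s} \<and> j \<in> {1..t}} \<union>
             {(Inr j, (i, j)) | i j. i \<in> {1..s} \<and> j \<in> {1..t}} \<rparr>"

lemma linearly_forced_mono:
  assumes "linearly_forced H \<sigma>" "\<sigma> \<le> \<tau>"
  shows "linearly_forced H \<tau>"
  unfolding linearly_forced_def
proof (intro allI impI)
  fix \<epsilon> :: real assume e: "\<epsilon> > 0"
  then obtain \<delta> where d: "\<And>G :: (nat, nat) bigraph.
        finite_bigraph G \<and> (left_side G \<noteq> {} \<or> right_side G \<noteq> {}) \<and>
        real (card (right_side G)) \<ge> \<epsilon> * real (card (left_side G)) powr \<sigma> \<and>
        real (card (edges G)) \<ge> \<delta> * real (card (right_side G))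
        \<Longrightarrow> contains_copy G H"
    using assms(1) unfolding linearly_forced_def by meson
  have "contains_copy G H" if G: "finite_bigraph G \<and> (left_side G \<noteq> {} \<or> right_side G \<noteq> {}) \<and>
        real (card (right_side G)) \<ge> \<epsilon> * real (card (left_side G)) powr \<tau> \<and>
        real (card (edges G)) \<ge> \<delta> * real (card (right_side G))" for G :: "(nat, nat) bigraph"
  proof (rule d)
    have "real (card (left_side G)) powr \<sigma> \<le> real (card (left_side G)) powr \<tau>"
      by (cases "card (left_side G)") (auto intro!: powr_mono assms(2))
    then have "\<epsilon> * real (card (left_side G)) powr \<sigma> \<le> \<epsilon> * real (card (left_side G)) powr \<tau>"
      using e by simp
    then show "finite_bigraph G \<and> (left_side G \<noteq> {} \<or> right_side G \<noteq> {}) \<and>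
        real (card (right_side G)) \<ge> \<epsilon> * real (card (left_side G)) powr \<sigma> \<and>
        real (card (edges G)) \<ge> \<delta> * real (card (right_side G))"
      using G by linarith
  qed
  then show "\<exists>\<delta>::real. \<forall>G :: (nat, nat) bigraph.
        finite_bigraph G \<and> (left_side G \<noteq> {} \<or> right_side G \<noteq> {}) \<and>
        real (card (right_side G)) \<ge> \<epsilon> * real (card (left_side G)) powr \<tau> \<and>
        real (card (edges G)) \<ge> \<delta> * real (card (right_side G))
        \<longrightarrow> contains_copy G H"
    by blast
qed

lemma linear_threshold_eqI:
  assumes "linearly_forced H \<sigma>" "\<And>\<tau>. linearly_forced H \<tau> \<Longrightarrow> \<sigma> \<le> \<tau>"
  shows "linear_threshold H = ereal \<sigma>"
  unfolding linear_threshold_def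
proof (rule antisym)
  show "Inf (ereal ` {\<sigma>. linearly_forced H \<sigma>}) \<le> ereal \<sigma>"
    using assms(1) by (intro Inf_lower) simp
  show "ereal \<sigma> \<le> Inf (ereal ` {\<sigma>. linearly_forced H \<sigma>})"
    using assms(2) by (intro Inf_greatest) auto
qed

lemma linearly_forcedD:
  fixes H :: "('a, 'b) bigraph" and \<epsilon> :: real
  assumes "linearly_forced H \<sigma>" "\<epsilon> > 0"
  obtains \<delta> :: real where "\<And>G :: ('c, 'd) bigraph.
        finite_bigraph G \<Longrightarrow> left_side G \<noteq> {} \<or> right_side G \<noteq> {} \<Longrightarrow>
        real (card (right_side G)) \<ge> \<epsilon> * real (card (left_side G)) powr \<sigma> \<Longrightarrow>
        real (card (edges G)) \<ge> \<delta> * real (card (right_side G)) \<Longrightarrow> contains_copy G H"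
proof -
  obtain \<delta> where d: "\<And>G :: (nat, nat) bigraph.
        finite_bigraph G \<and> (left_side G \<noteq> {} \<or> right_side G \<noteq> {}) \<and>
        real (card (right_side G)) \<ge> \<epsilon> * real (card (left_side G)) powr \<sigma> \<and>
        real (card (edges G)) \<ge> \<delta> * real (card (right_side G))
        \<Longrightarrow> contains_copy G H"
    using assms unfolding linearly_forced_def by meson
  have "contains_copy G H" if G: "finite_bigraph G" "left_side G \<noteq> {} \<or> right_side G \<noteq> {}"
        "real (card (right_side G)) \<ge> \<epsilon> * real (card (left_side G)) powr \<sigma>"
        "real (card (edges G)) \<ge> \<delta> * real (card (right_side G))" for G :: "('c, 'd) bigraph"
  proof -
    have fin: "finite (left_side G)" "finite (right_side G)"
      and sub: "edges G \<subseteq> left_side G \<times> right_side G"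
      using G(1) unfolding finite_bigraph_def by auto
    obtain p :: "'c \<Rightarrow> nat" where p: "inj_on p (left_side G)"
      using finite_imp_inj_to_nat_seg[OF fin(1)] by blast
    obtain q :: "'d \<Rightarrow> nat" where q: "inj_on q (right_side G)"
      using finite_imp_inj_to_nat_seg[OF fin(2)] by blast
    define G' :: "(nat, nat) bigraph" where "G' = \<lparr>left_side = p ` left_side G,
      right_side = q ` right_side G, edges = map_prod p q ` edges G\<rparr>"
    have inj: "inj_on (map_prod p q) (edges G)"
      by (rule inj_on_subset[OF map_prod_inj_on[OF p q] sub])
    have "contains_copy G' H"
      by (rule d) (use G fin sub in \<open>auto simp: G'_def finite_bigraph_def card_image p q inj\<close>)
    then obtain f g where fg: "is_copy H G' f g" unfolding contains_copy_def by blast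
    have inv1: "inj_on (inv_into (left_side G) p) (p ` left_side G)"
      and inv2: "inj_on (inv_into (right_side G) q) (q ` right_side G)"
      by (simp_all add: inj_on_inv_into)
    have "is_copy H G (inv_into (left_side G) p \<circ> f) (inv_into (right_side G) q \<circ> g)"
      unfolding is_copy_def
    proof (intro conjI ballI)
      show "inj_on (inv_into (left_side G) p \<circ> f) (left_side H)"
        using fg inv1 unfolding is_copy_def G'_def
        by (auto intro!: comp_inj_on intro: inj_on_subset)
      show "inj_on (inv_into (right_side G) q \<circ> g) (right_side H)"
        using fg inv2 unfolding is_copy_def G'_def
        by (auto intro!: comp_inj_on intro: inj_on_subset)
      show "(inv_into (left_side G) p \<circ> f) ` left_side H \<subseteq> left_side G"
        using fg unfolding is_copy_def G'_def by (auto simp: image_subset_iff intro!: inv_into_into)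
      show "(inv_into (right_side G) q \<circ> g) ` right_side H \<subseteq> right_side G"
        using fg unfolding is_copy_def G'_def by (auto simp: image_subset_iff intro!: inv_into_into)
    next
      fix e assume "e \<in> edges H"
      then obtain a b where ab: "e = (a, b)" "(f a, g b) \<in> edges G'"
        using fg unfolding is_copy_def by (cases e) auto
      then obtain x y where xy: "(x, y) \<in> edges G" "f a = p x" "g b = q y"
        unfolding G'_def by auto
      then have "x \<in> left_side G" "y \<in> right_side G" using sub by auto
      then show "case e of (a, b) \<Rightarrow> ((inv_into (left_side G) p \<circ> f) a,
          (inv_into (right_side G) q \<circ> g) b) \<in> edges G"
        using xy ab p q by simp
    qed
    then show ?thesis unfolding contains_copy_def by blast
  qed
  then show ?thesis using that by blast
qed

lemma linear_threshold_subdiv_1_1: "linear_threshold (subdiv 1 1) = -\<infinity>"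
proof -
  have "linearly_forced (subdiv 1 1) \<sigma>" for \<sigma>
    unfolding linearly_forced_def
  proof (intro allI impI exI[of _ 2])
    fix \<epsilon> :: real and G :: "(nat, nat) bigraph"
    assume e: "\<epsilon> > 0"
      and "finite_bigraph G \<and> (left_side G \<noteq> {} \<or> right_side G \<noteq> {}) \<and>
        real (card (right_side G)) \<ge> \<epsilon> * real (card (left_side G)) powr \<sigma> \<and>
        real (card (edges G)) \<ge> 2 * real (card (right_side G))"
    then have fin: "finite (left_side G)" "finite (right_side G)"
      and sub: "edges G \<subseteq> left_side G \<times> right_side G"
      and ne: "left_side G \<noteq> {} \<or> right_side G \<noteq> {}"
      and V: "real (card (right_side G)) \<ge> \<epsilon> * real (card (left_side G)) powr \<sigma>"
      and E: "card (edges G) \<ge> 2 * card (right_side G)"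
      by (auto simp: finite_bigraph_def)
    have Vne: "right_side G \<noteq> {}"
    proof
      assume "right_side G = {}"
      then have "left_side G \<noteq> {}" "\<epsilon> * real (card (left_side G)) powr \<sigma> \<le> 0" using ne V by auto
      moreover from this have "real (card (left_side G)) > 0" using fin by (simp add: card_gt_0_iff)
      ultimately show False using e by (simp add: mult_le_0_iff)
    qed
    have "\<not> inj_on snd (edges G)"
    proof
      assume "inj_on snd (edges G)"
      moreover have "snd ` edges G \<subseteq> right_side G" using sub by auto
      ultimately have "card (edges G) \<le> card (right_side G)"
        using fin by (metis card_image card_mono)
      moreover have "card (right_side G) > 0" using Vne fin by (simp add: card_gt_0_iff)
      ultimately show False using E by linarith
    qed
    then obtain x y z where xyz: "(x, z) \<in> edges G" "(y, z) \<in> edges G" "x \<noteq> y"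
      unfolding inj_on_def by (metis prod.collapse)
    have "is_copy (subdiv 1 1) G (case_sum (\<lambda>_. x) (\<lambda>_. y)) (\<lambda>_. z)"
      using xyz sub by (auto simp: is_copy_def subdiv_def inj_on_def)
    then show "contains_copy G (subdiv 1 1)" unfolding contains_copy_def by blast
  qed
  then have all: "{\<sigma>. linearly_forced (subdiv 1 1) \<sigma>} = UNIV" by blast
  show ?thesis
    unfolding linear_threshold_def all by (rule ereal_bot) (auto intro: Inf_lower)
qed

end

theory Submission
  imports Defs "HOL-Library.FuncSet"
begin

text \<open>
  Upper bound: cut the neighbourhoods of the right vertices into blocks of a large constant size
  \<open>D\<close>, coloured by their right vertex, and call a pair of left vertices heavy if at least \<open>s t\<close>
  colours join it. A block with \<open>D\<^sup>2 / 2\<close> heavy ordered pairs contains a heavy \<open>K\<^sub>s\<^sub>,\<^sub>t\<close>, whose edges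
  receive distinct colours greedily. Otherwise there are of order \<open>\<epsilon> D\<^sup>2 n\<^bsup>2 - 1/s\<^esup>\<close> light pairs, and
  counting stars with \<open>s\<close> leaves and distinct colours gives \<open>s\<close> leaves with of order
  \<open>(\<epsilon> D\<^sup>2)\<^sup>s\<close> common centres. A centre shares a colour with at most \<open>s\<^sup>2 D\<close> of them, so for
  large \<open>D\<close> there are \<open>t\<close> centres with pairwise disjoint colour sets.

  Lower bound: join each of \<open>n\<^sup>\<rho>\<close> right vertices to a random vertex in each of \<open>d\<close> classes of size
  \<open>n\<close>, where \<open>\<sigma> < \<rho> < 2 - 1/s\<close>, and delete a right vertex of every copy. The expected number of
  copies is of order \<open>n\<^bsup>s + t + \<rho>st - 2st\<^esup>\<close>, which is \<open>o(n\<^sup>\<rho>)\<close> once \<open>t\<close> is large.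
\<close>

subsection \<open>Counting and greedy selection\<close>

text \<open>The list grows one entry at a time: fewer than \<open>s\<close> colours are already
  used, each of them rules out at most \<open>q\<close> elements, and so at least \<open>r\<close>
  choices remain in every round.\<close>

lemma card_rainbow_lists:
  fixes A :: "'a set" and \<gamma> :: "'a \<Rightarrow> 'c" and r :: real
  assumes "finite A" and fib: "\<And>c. card {y \<in> A. \<gamma> y = c} \<le> q"
    and r: "0 \<le> r" "r + real s * real q \<le> real (card A)" and "k \<le> s"
  shows "r ^ k \<le> real (card {ys. length ys = k \<and> set ys \<subseteq> A \<and> distinct (map \<gamma> ys)})"
  using \<open>k \<le> s\<close>
proof (induction k)
  case 0
  have "{ys. length ys = 0 \<and> set ys \<subseteq> A \<and> distinct (map \<gamma> ys)} = {[]}" by auto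
  then show ?case by simp
next
  case (Suc k)
  define T where "T k = {ys. length ys = k \<and> set ys \<subseteq> A \<and> distinct (map \<gamma> ys)}" for k
  define W where "W ys = {y \<in> A. \<gamma> y \<notin> \<gamma> ` set ys}" for ys
  have fin: "finite (T k)"
    by (rule finite_subset[OF _ finite_lists_length_eq[OF assms(1), of k]]) (auto simp: T_def)
  have W: "r \<le> real (card (W ys))" if "ys \<in> T k" for ys
  proof -
    have len: "card (\<gamma> ` set ys) \<le> k"
      using that card_image_le[of "set ys" \<gamma>] card_length[of ys] by (auto simp: T_def)
    have "A - W ys = (\<Union>c \<in> \<gamma> ` set ys. {y \<in> A. \<gamma> y = c})" by (auto simp: W_def)
    then have "card (A - W ys) \<le> (\<Sum>c \<in> \<gamma> ` set ys. card {y \<in> A. \<gamma> y = c})"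
      using card_UN_le[of "\<gamma> ` set ys" "\<lambda>c. {y \<in> A. \<gamma> y = c}"] by simp
    also have "\<dots> \<le> card (\<gamma> ` set ys) * q"
      using sum_bounded_above[of "\<gamma> ` set ys" "\<lambda>c. card {y \<in> A. \<gamma> y = c}" q] fib by simp
    also have "\<dots> \<le> s * q" using len Suc.prems by (intro mult_right_mono) auto
    finally have "card A - card (W ys) \<le> s * q"
      using assms(1) by (subst (asm) card_Diff_subset) (auto simp: W_def)
    then have "real (card A) \<le> real (card (W ys)) + real (s * q)" by linarith
    then show ?thesis using r by simp
  qed
  have "T (Suc k) = (\<lambda>(ys, y). y # ys) ` (SIGMA ys : T k. W ys)"
    by (auto simp: T_def W_def length_Suc_conv image_iff)
  moreover have "inj_on (\<lambda>(ys, y). y # ys) (SIGMA ys : T k. W ys)" by (auto simp: inj_on_def)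
  moreover have "finite (W ys)" for ys using assms(1) by (simp add: W_def)
  ultimately have "card (T (Suc k)) = (\<Sum>ys\<in>T k. card (W ys))"
    using fin by (simp add: card_image)
  then have "real (card (T (Suc k))) = (\<Sum>ys\<in>T k. real (card (W ys)))" by simp
  also have "\<dots> \<ge> real (card (T k)) * r"
    using sum_bounded_below[of "T k" r "\<lambda>ys. real (card (W ys))"] W by simp
  finally have "real (card (T k)) * r \<le> real (card (T (Suc k)))" .
  moreover have "r ^ k * r \<le> real (card (T k)) * r"
    using Suc r(1) by (intro mult_right_mono) (auto simp: T_def)
  ultimately show ?case by (simp add: T_def mult.commute)
qed

text \<open>A power mean inequality in the form needed for counting stars: if the average of
  \<open>r\<close> is at least \<open>b\<close>, then the average of its \<open>s\<close>-th power
  is at least \<open>b ^ s\<close>.\<close>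

lemma sum_power_ge:
  fixes r :: "'b \<Rightarrow> real"
  assumes "finite X" "b > 0" "\<And>x. x \<in> X \<Longrightarrow> 0 \<le> r x" "b * real (card X) \<le> (\<Sum>x\<in>X. r x)"
  shows "b ^ s * real (card X) \<le> (\<Sum>x\<in>X. r x ^ s)"
proof -
  \<comment> \<open>Bernoulli's inequality at \<open>r x / b\<close> bounds the power from below by
    its tangent line at \<open>b\<close>. The tangent line is affine, so its sum over
    \<open>X\<close> depends only on the average of \<open>r\<close>.\<close>
  have "b ^ s * (1 + real s * (r x / b - 1)) \<le> r x ^ s" if "x \<in> X" for x
  proof -
    have "1 + real s * (r x / b - 1) \<le> (1 + (r x / b - 1)) ^ s"
      using assms(2) assms(3)[OF that] by (intro Bernoulli_inequality) auto
    then have "b ^ s * (1 + real s * (r x / b - 1)) \<le> b ^ s * (r x / b) ^ s"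
      using assms(2) by (intro mult_left_mono) auto
    also have "\<dots> = r x ^ s" using assms(2) by (simp flip: power_mult_distrib)
    finally show ?thesis .
  qed
  then have "(\<Sum>x\<in>X. b ^ s * (1 + real s * (r x / b - 1))) \<le> (\<Sum>x\<in>X. r x ^ s)"
    by (rule sum_mono)
  moreover have "(\<Sum>x\<in>X. b ^ s * (1 + real s * (r x / b - 1)))
      = b ^ s * (real (card X) + real s * ((\<Sum>x\<in>X. r x) / b - real (card X)))"
    by (simp add: sum.distrib sum_subtractf flip: sum_distrib_left sum_divide_distrib)
  moreover have "b ^ s * real (card X)
      \<le> b ^ s * (real (card X) + real s * ((\<Sum>x\<in>X. r x) / b - real (card X)))"
  proof -
    have "real (card X) \<le> (\<Sum>x\<in>X. r x) / b" using assms(2,4) by (simp add: field_simps)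
    then show ?thesis using assms(2) by (intro mult_left_mono) auto
  qed
  ultimately show ?thesis by linarith
qed

text \<open>Double counting of stars: a centre \<open>x\<close> together with a list of
  \<open>s\<close> leaves in \<open>A x\<close> whose colours under \<open>\<gamma> x\<close> are
  distinct. The two preceding lemmas bound their number from below, and some list among the
  \<open>card Y ^ s\<close> possible ones attains at least the average number of centres.\<close>

lemma popular_rainbow_list:
  fixes A :: "'b \<Rightarrow> 'a set" and \<gamma> :: "'b \<Rightarrow> 'a \<Rightarrow> 'c" and b :: real
  assumes X: "finite X" "X \<noteq> {}" and Y: "finite Y" "\<And>x. x \<in> X \<Longrightarrow> A x \<subseteq> Y"
    and fib: "\<And>x c. x \<in> X \<Longrightarrow> card {y \<in> A x. \<gamma> x y = c} \<le> q"
    and b: "b > 0" "(real s * real q + b) * real (card X) \<le> (\<Sum>x\<in>X. real (card (A x)))"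
  obtains ys where "length ys = s"
    "b ^ s * real (card X)
      \<le> real (card {x \<in> X. set ys \<subseteq> A x \<and> distinct (map (\<gamma> x) ys)}) * real (card Y) ^ s"
proof -
  define T where "T x = {ys. length ys = s \<and> set ys \<subseteq> A x \<and> distinct (map (\<gamma> x) ys)}" for x
  define L where "L = {ys. set ys \<subseteq> Y \<and> length ys = s}"
  \<comment> \<open>Truncation at 0 supplies the nonnegativity needed for the power inequality, and
    can only increase the sum.\<close>
  define r where "r x = max 0 (real (card (A x)) - real s * real q)" for x
  define c where "c ys = card {x \<in> X. set ys \<subseteq> A x \<and> distinct (map (\<gamma> x) ys)}" for ys
  have finA: "finite (A x)" if "x \<in> X" for x using Y that by (meson finite_subset)
  have rT: "r x ^ s \<le> real (card (T x))" if x: "x \<in> X" for x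
  proof (cases "real s * real q \<le> real (card (A x))")
    case True
    then show ?thesis unfolding T_def
      by (intro card_rainbow_lists[OF finA[OF x] fib[OF x]]) (auto simp: r_def)
  next
    case False
    \<comment> \<open>The bound must be \<open>0 ^ s = 0\<close> here. This excludes
      \<open>0 ^ 0 = 1\<close>, because for \<open>s = 0\<close> the other case applies.\<close>
    then have "s \<noteq> 0" by (cases s) auto
    moreover have "r x = 0" using False by (simp add: r_def)
    ultimately show ?thesis by (simp add: zero_power)
  qed
  have "(\<Sum>x\<in>X. real (card (A x)) - real s * real q) \<le> (\<Sum>x\<in>X. r x)"
    by (intro sum_mono) (auto simp: r_def)
  then have "b * real (card X) \<le> (\<Sum>x\<in>X. r x)"
    using b(2) by (simp add: sum_subtractf algebra_simps)
  then have "b ^ s * real (card X) \<le> (\<Sum>x\<in>X. r x ^ s)"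
    by (intro sum_power_ge X b) (auto simp: r_def)
  also have "\<dots> \<le> real (\<Sum>x\<in>X. card (T x))" using rT by (simp add: sum_mono)
  also have "(\<Sum>x\<in>X. card (T x)) = (\<Sum>ys\<in>L. c ys)"
  proof -
    have "(\<Sum>x\<in>X. card (T x)) = (\<Sum>x\<in>X. card {ys \<in> L. ys \<in> T x})"
      using Y(2) by (intro sum.cong refl arg_cong[of _ _ card]) (auto simp: T_def L_def)
    also have "\<dots> = (\<Sum>ys\<in>L. card {x \<in> X. ys \<in> T x})"
      using sum_multicount_gen[of L X "\<lambda>ys x. ys \<in> T x" "\<lambda>x. card {ys \<in> L. ys \<in> T x}"]
        X(1) finite_lists_length_eq[OF Y(1), of s] by (simp add: L_def)
    also have "\<dots> = (\<Sum>ys\<in>L. c ys)"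
      by (intro sum.cong refl) (auto simp: c_def T_def L_def intro!: arg_cong[of _ _ card])
    finally show ?thesis .
  qed
  finally have main: "b ^ s * real (card X) \<le> (\<Sum>ys\<in>L. real (c ys))" by simp
  have cL: "card L = card Y ^ s" and finL: "finite L"
    unfolding L_def using Y(1) by (auto simp: card_lists_length_eq finite_lists_length_eq)
  have pos: "b ^ s * real (card X) > 0" using X b(1) by (simp add: card_gt_0_iff)
  then have "L \<noteq> {}" using main by auto
  have "\<exists>ys\<in>L. b ^ s * real (card X) \<le> real (c ys) * real (card Y) ^ s"
  proof (rule ccontr)
    assume "\<not> ?thesis"
    then have "(\<Sum>ys\<in>L. real (c ys) * real (card L)) < (\<Sum>ys\<in>L. b ^ s * real (card X))"
      using finL \<open>L \<noteq> {}\<close> by (intro sum_strict_mono) (auto simp: cL not_le)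
    then have "real (card L) * (\<Sum>ys\<in>L. real (c ys)) < real (card L) * (b ^ s * real (card X))"
      by (simp add: mult.commute sum_distrib_left)
    then show False using main by (meson mult_left_mono not_le of_nat_0_le_iff)
  qed
  then show ?thesis using that by (auto simp: c_def L_def)
qed

section \<open>Greedy selection\<close>

text \<open>Choosing \<open>x\<close> and discarding everything in conflict with it,
  \<open>x\<close> itself included by reflexivity, costs at most \<open>q\<close> elements, so
  \<open>t * q\<close> elements last for \<open>t\<close> rounds.\<close>

lemma independent_subset:
  assumes "finite X" "\<And>x. x \<in> X \<Longrightarrow> card {y \<in> X. conf x y} \<le> q"
    and "\<And>x y. conf x y \<Longrightarrow> conf y x" "\<And>x. x \<in> X \<Longrightarrow> conf x x" "t * q \<le> card X"
    "q > 0"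
  obtains T where "T \<subseteq> X" "card T = t" "\<And>x y. x \<in> T \<Longrightarrow> y \<in> T \<Longrightarrow> x \<noteq> y \<Longrightarrow> \<not> conf x y"
proof -
  have "\<exists>T\<subseteq>X. card T = t \<and> (\<forall>x\<in>T. \<forall>y\<in>T. x \<noteq> y \<longrightarrow> \<not> conf x y)"
    using assms(1,2,4,5)
  proof (induction t arbitrary: X)
    case 0
    then show ?case by (intro exI[of _ "{}"]) auto
  next
    case (Suc t)
    then obtain x where x: "x \<in> X" using assms(6) by fastforce
    define X' where "X' = {y \<in> X. \<not> conf x y}"
    have "card X = card X' + card {y \<in> X. conf x y}"
      unfolding X'_def using Suc.prems(1)
      by (subst card_Un_disjoint[symmetric]) (auto intro: arg_cong[of _ _ card])
    then have "t * q \<le> card X'" using Suc.prems(4) Suc.prems(2)[OF x] by simp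
    moreover have "card {z \<in> X'. conf y z} \<le> q" if "y \<in> X'" for y
    proof -
      have "card {z \<in> X'. conf y z} \<le> card {z \<in> X. conf y z}"
        using Suc.prems(1) by (intro card_mono) (auto simp: X'_def)
      also have "\<dots> \<le> q" using Suc.prems(2) that by (simp add: X'_def)
      finally show ?thesis .
    qed
    ultimately have "\<exists>T\<subseteq>X'. card T = t \<and> (\<forall>x\<in>T. \<forall>y\<in>T. x \<noteq> y \<longrightarrow> \<not> conf x y)"
      using Suc.prems by (intro Suc.IH) (auto simp: X'_def)
    then obtain T where T: "T \<subseteq> X'" "card T = t"
        "\<forall>x\<in>T. \<forall>y\<in>T. x \<noteq> y \<longrightarrow> \<not> conf x y"
      by blast
    have "x \<notin> T" using T(1) Suc.prems(3)[OF x] by (auto simp: X'_def)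
    moreover have "finite T" using T(1) Suc.prems(1) by (auto simp: X'_def intro: finite_subset)
    moreover have "insert x T \<subseteq> X" using T(1) x by (auto simp: X'_def)
    moreover have "\<not> conf x y \<and> \<not> conf y x" if "y \<in> T" for y
      using T(1) assms(3) that by (auto simp: X'_def)
    ultimately show ?case
      using T(2,3) by (intro exI[of _ "insert x T"] conjI ballI impI) auto
  qed
  then show ?thesis using that by blast
qed

text \<open>Every \<open>C j\<close> is at least as large as the whole index set, so the values used
  earlier never exhaust it, and a greedy choice takes the place of Hall's theorem.\<close>

lemma distinct_representatives:
  assumes "finite J" "\<And>j. j \<in> J \<Longrightarrow> card J \<le> card (C j)"
  obtains g where "inj_on g J" "\<And>j. j \<in> J \<Longrightarrow> g j \<in> C j"
proof -
  have "\<exists>g. inj_on g K \<and> (\<forall>j\<in>K. g j \<in> C j)" if "K \<subseteq> J" for K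
    using finite_subset[OF that assms(1)] that
  proof (induction K rule: finite_induct)
    case empty
    then show ?case by simp
  next
    case (insert k K)
    then obtain g where g: "inj_on g K" "\<forall>j\<in>K. g j \<in> C j" by auto
    have "card (g ` K) < card (insert k K)" using insert by (simp add: card_image g(1))
    also have "\<dots> \<le> card (C k)" using insert assms by (meson card_mono insert_subset order_trans)
    finally have "\<not> C k \<subseteq> g ` K" using insert by (meson card_mono finite_imageI not_le)
    then obtain c where "c \<in> C k" "c \<notin> g ` K" by auto
    moreover have "(g(k := c)) ` (K - {k}) = g ` K" using insert(2) by auto
    moreover have "inj_on (g(k := c)) K"
      using insert(2) g(1) inj_on_cong[of K g "g(k := c)"] by fastforce
    ultimately have "inj_on (g(k := c)) (insert k K)" by (simp only: inj_on_insert fun_upd_same simp_thms)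
    moreover have "\<forall>j\<in>insert k K. (g(k := c)) j \<in> C j" using \<open>c \<in> C k\<close> g(2) by simp
    ultimately show ?case by blast
  qed
  then show ?thesis using that by blast
qed

lemma disjoint_blocks:
  assumes "finite S" "D > 0"
  obtains P where "finite P" "card P = card S div D" "\<And>e. e \<in> P \<Longrightarrow> e \<subseteq> S \<and> card e = D"
    "\<And>e e'. e \<in> P \<Longrightarrow> e' \<in> P \<Longrightarrow> e \<noteq> e' \<Longrightarrow> e \<inter> e' = {}"
proof -
  have "\<exists>P. finite P \<and> card P = k \<and> (\<forall>e\<in>P. e \<subseteq> S \<and> card e = D) \<and>
      (\<forall>e\<in>P. \<forall>e'\<in>P. e \<noteq> e' \<longrightarrow> e \<inter> e' = {})" if "k * D \<le> card S" for k
    using that assms(1)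
  proof (induction k arbitrary: S)
    case 0
    then show ?case by (intro exI[of _ "{}"]) auto
  next
    case (Suc k)
    then obtain e where e: "e \<subseteq> S" "card e = D" "finite e"
      by (metis le_add1 mult_Suc obtain_subset_with_card_n order_trans)
    then have "k * D \<le> card (S - e)" using Suc.prems by (simp add: card_Diff_subset)
    then obtain P where P: "finite P" "card P = k" "\<forall>e'\<in>P. e' \<subseteq> S - e \<and> card e' = D"
        "\<forall>e\<in>P. \<forall>e'\<in>P. e \<noteq> e' \<longrightarrow> e \<inter> e' = {}"
      using Suc.IH[of "S - e"] Suc.prems(2) by auto
    have disj: "e \<inter> e' = {}" "e' \<subseteq> S" "card e' = D" if "e' \<in> P" for e'
      using P(3) that by blast+
    \<comment> \<open>A member of \<open>P\<close> is disjoint from \<open>e\<close>; if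
      \<open>e\<close> were one, it would be empty, against \<open>D > 0\<close>.\<close>
    have "e \<notin> P" using disj(1)[of e] e(2) assms(2) by auto
    moreover have "\<forall>e1\<in>insert e P. \<forall>e2\<in>insert e P. e1 \<noteq> e2 \<longrightarrow> e1 \<inter> e2 = {}"
      using P(4) disj(1) by (simp add: Int_commute)
    moreover have "\<forall>e'\<in>insert e P. e' \<subseteq> S \<and> card e' = D" using disj e by simp
    ultimately show ?case using P(1,2) by (intro exI[of _ "insert e P"]) simp
  qed
  from this[of "card S div D"] show ?thesis using that by auto
qed

section \<open>Assembling a copy from lists of vertices\<close>

text \<open>Translates between the indices of lists, which start at 0, and those of
  \<open>subdiv\<close>, which start at 1. The list \<open>ys\<close> carries the vertices
  \<open>u\<close>, the list \<open>xs\<close> the vertices \<open>v\<close>, and \<open>g\<close>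
  the subdividing vertices.\<close>

lemma contains_subdivI:
  assumes "finite_bigraph G" "length ys = s" "length xs = t" "distinct ys" "distinct xs"
    and inj: "inj_on g ({..<s} \<times> {..<t})"
    and dj: "s > 0" "t > 0" "set ys \<inter> set xs = {}"
    and adj: "\<And>i j. i < s \<Longrightarrow> j < t \<Longrightarrow>
      (ys ! i, g (i, j)) \<in> edges G \<and> (xs ! j, g (i, j)) \<in> edges G"
  shows "contains_copy G (subdiv s t)"
proof -
  define f where "f = case_sum (\<lambda>i. ys ! (i - 1)) (\<lambda>j. xs ! (j - 1))"
  define h where "h = (\<lambda>(i, j). g (i - 1, j - 1))"
  have sub: "edges G \<subseteq> left_side G \<times> right_side G" using assms(1) by (simp add: finite_bigraph_def)
  have adj': "(ys ! (i - 1), g (i - 1, j - 1)) \<in> edges G"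
      "(xs ! (j - 1), g (i - 1, j - 1)) \<in> edges G" if "i \<in> {1..s}" "j \<in> {1..t}" for i j
    using adj[of "i - 1" "j - 1"] that by auto
  have ne: "ys ! i \<noteq> xs ! j" if "i < s" "j < t" for i j
    using dj that assms(2,3) by (metis disjoint_iff nth_mem)
  have "is_copy (subdiv s t) G f h"
    unfolding is_copy_def
  proof (intro conjI)
    have "inj_on (\<lambda>i. zs ! (i - 1)) {1..length zs}" if "distinct zs" for zs :: "'a list"
      by (intro inj_onI) (use that in \<open>auto simp: nth_eq_iff_index_eq\<close>)
    then have inj_nth: "inj_on (\<lambda>i. ys ! (i - 1)) {1..s}" "inj_on (\<lambda>j. xs ! (j - 1)) {1..t}"
      using assms(2-5) by blast+
    have ne': "ys ! (i - 1) \<noteq> xs ! (j - 1)" if "i \<in> {1..s}" "j \<in> {1..t}" for i j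
      using that by (intro ne) auto
    show "inj_on f (left_side (subdiv s t))"
    proof (rule inj_onI)
      fix a b assume ab: "a \<in> left_side (subdiv s t)" "b \<in> left_side (subdiv s t)" "f a = f b"
      show "a = b"
      proof (cases a)
        case a: (Inl i)
        show ?thesis
        proof (cases b)
          case (Inl k)
          then show ?thesis using ab a inj_onD[OF inj_nth(1), of i k] by (auto simp: f_def subdiv_def)
        next
          case (Inr k)
          then show ?thesis using ab a ne'[of i k] by (auto simp: f_def subdiv_def)
        qed
      next
        case a: (Inr i)
        show ?thesis
        proof (cases b)
          case (Inl k)
          then show ?thesis using ab a ne'[of k i] by (auto simp: f_def subdiv_def)
        next
          case (Inr k)
          then show ?thesis using ab a inj_onD[OF inj_nth(2), of i k] by (auto simp: f_def subdiv_def)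
        qed
      qed
    qed
    show "f ` left_side (subdiv s t) \<subseteq> left_side G"
    proof (rule image_subsetI)
      fix a assume "a \<in> left_side (subdiv s t)"
      then consider i where "a = Inl i" "i \<in> {1..s}" | j where "a = Inr j" "j \<in> {1..t}"
        by (auto simp: subdiv_def)
      then show "f a \<in> left_side G"
      proof cases
        case 1
        \<comment> \<open>Membership in the left side is read off from an incident edge. Positivity
          of \<open>t\<close> provides the index 0 for it, and symmetrically that of
          \<open>s\<close> in the other case.\<close>
        then have "(f a, g (i - 1, 0)) \<in> edges G" using adj'(1)[of i 1] dj by (simp add: f_def)
        then show ?thesis using sub by blast
      next
        case 2
        then have "(f a, g (0, j - 1)) \<in> edges G" using adj'(2)[of 1 j] dj by (simp add: f_def)
        then show ?thesis using sub by blast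
      qed
    qed
    show "inj_on h (right_side (subdiv s t))"
      unfolding inj_on_def
    proof (intro ballI impI)
      fix a b assume ab: "a \<in> right_side (subdiv s t)" "b \<in> right_side (subdiv s t)" "h a = h b"
      obtain i j i' j' where [simp]: "a = (i, j)" "b = (i', j')" by (cases a; cases b)
      have "(i - 1, j - 1) = (i' - 1, j' - 1)"
        using ab by (intro inj_onD[OF inj]) (auto simp: h_def subdiv_def)
      then show "a = b" using ab by (auto simp: subdiv_def)
    qed
    show "h ` right_side (subdiv s t) \<subseteq> right_side G"
    proof (rule image_subsetI)
      fix b assume "b \<in> right_side (subdiv s t)"
      then obtain i j where "b = (i, j)" "i \<in> {1..s}" "j \<in> {1..t}" by (auto simp: subdiv_def)
      then have "(ys ! (i - 1), h b) \<in> edges G" using adj'(1) by (simp add: h_def)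
      then show "h b \<in> right_side G" using sub by blast
    qed
    show "\<forall>(a, b)\<in>edges (subdiv s t). (f a, h b) \<in> edges G"
      using adj' by (auto simp: f_def h_def subdiv_def)
  qed
  then show ?thesis unfolding contains_copy_def by blast
qed

subsection \<open>Upper bound\<close>

text \<open>A pair \<open>(c, e)\<close> is a block \<open>e\<close> inside the neighbourhood of the
  right vertex \<open>c\<close>, and \<open>c\<close> is the colour of all pairs in
  \<open>e\<close>. Each colour class is thus a disjoint union of cliques of order \<open>D\<close>,
  which keeps its degrees below a constant even if \<open>c\<close> has huge degree.\<close>

locale block_system =
  fixes G :: "('a, 'b) bigraph" and B :: "('b \<times> 'a set) set" and D :: nat
  assumes fin: "finite_bigraph G"
    and block_edges: "(c, e) \<in> B \<Longrightarrow> x \<in> e \<Longrightarrow> (x, c) \<in> edges G"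
    and block_card: "(c, e) \<in> B \<Longrightarrow> card e = D"
    and block_disjoint: "(c, e) \<in> B \<Longrightarrow> (c, e') \<in> B \<Longrightarrow> x \<in> e \<Longrightarrow> x \<in> e' \<Longrightarrow> e = e'"
    and D_pos: "D > 0"
begin

definition colours :: "'a \<Rightarrow> 'a \<Rightarrow> 'b set" where
  "colours x y = {c. \<exists>e. (c, e) \<in> B \<and> x \<in> e \<and> y \<in> e \<and> x \<noteq> y}"

definition heavy :: "nat \<Rightarrow> 'a \<Rightarrow> 'a \<Rightarrow> bool" where
  "heavy m x y \<longleftrightarrow> m \<le> card (colours x y)"

text \<open>Nonemptiness confines the notion to pairs inside a common block, so that a colour can be
  chosen for each light pair and its two vertices are distinct.\<close>

definition light :: "nat \<Rightarrow> 'a \<Rightarrow> 'a \<Rightarrow> bool" where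
  "light m x y \<longleftrightarrow> colours x y \<noteq> {} \<and> \<not> heavy m x y"

lemma colours_commute: "colours x y = colours y x"
  by (auto simp: colours_def)

lemma colours_edges:
  assumes "c \<in> colours x y"
  shows "(x, c) \<in> edges G" "(y, c) \<in> edges G" "x \<noteq> y"
  using assms block_edges by (auto simp: colours_def)

lemma finite_sides [simp]: "finite (left_side G)" "finite (right_side G)"
  using fin by (simp_all add: finite_bigraph_def)

lemma edges_sub: "edges G \<subseteq> left_side G \<times> right_side G"
  using fin by (simp add: finite_bigraph_def)

lemma finite_block: "(c, e) \<in> B \<Longrightarrow> finite e"
  using block_card D_pos card_ge_0_finite by metis

lemma block_sub: "(c, e) \<in> B \<Longrightarrow> e \<subseteq> left_side G"
  using block_edges edges_sub by blast

lemma block_colour: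
  assumes "(c, e) \<in> B"
  shows "c \<in> right_side G"
proof -
  have "e \<noteq> {}" using block_card[OF assms] D_pos by auto
  then show ?thesis using block_edges[OF assms] edges_sub by blast
qed

lemma finite_B: "finite B"
  by (rule finite_subset[of _ "right_side G \<times> Pow (left_side G)"])
    (use block_sub block_colour in auto)

text \<open>At most one block of colour \<open>c\<close> passes through \<open>x\<close>, and it
  contains every such \<open>y\<close>. This bound is the reason for working with blocks instead of
  full neighbourhoods.\<close>

lemma colour_fibre: "finite {y. c \<in> colours x y} \<and> card {y. c \<in> colours x y} \<le> D"
proof (cases "\<exists>e. (c, e) \<in> B \<and> x \<in> e")
  case True
  then obtain e where e: "(c, e) \<in> B" "x \<in> e" by blast
  then have "{y. c \<in> colours x y} \<subseteq> e" using block_disjoint by (auto simp: colours_def)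
  then show ?thesis using e finite_block block_card by (metis card_mono finite_subset)
next
  case False
  then have "{y. c \<in> colours x y} = {}" by (auto simp: colours_def)
  then show ?thesis by (metis card.empty finite.emptyI le0)
qed

text \<open>Blocks of the same colour are disjoint, so a block containing both vertices is
  determined by its colour.\<close>

lemma card_colours:
  assumes "x \<noteq> y"
  shows "card {p \<in> B. x \<in> snd p \<and> y \<in> snd p} = card (colours x y)"
proof -
  have inj: "inj_on fst {p \<in> B. x \<in> snd p \<and> y \<in> snd p}"
    using block_disjoint by (fastforce simp: inj_on_def)
  have "fst ` {p \<in> B. x \<in> snd p \<and> y \<in> snd p} = colours x y"
    using assms by (force simp: colours_def image_iff)
  then show ?thesis using card_image[OF inj] by simp
qed

text \<open>Each of the \<open>s * t\<close> pairs has at least \<open>s * t\<close> colours, so the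
  subdividing vertices can be picked as distinct representatives of the colour sets.\<close>

lemma heavy_biclique_contains:
  assumes "s > 0" "t > 0" "length ys = s" "length xs = t" "distinct ys" "distinct xs"
    and h: "\<And>x y. x \<in> set xs \<Longrightarrow> y \<in> set ys \<Longrightarrow> heavy (s * t) x y"
  shows "contains_copy G (subdiv s t)"
proof -
  define J where "J = {..<s} \<times> {..<t}"
  have "card J \<le> card (case p of (i, j) \<Rightarrow> colours (xs ! j) (ys ! i))" if "p \<in> J" for p
    using h that assms(3,4) by (auto simp: J_def heavy_def)
  then obtain g where g: "inj_on g J"
      "\<And>p. p \<in> J \<Longrightarrow> g p \<in> (case p of (i, j) \<Rightarrow> colours (xs ! j) (ys ! i))"
    using distinct_representatives[of J "\<lambda>(i, j). colours (xs ! j) (ys ! i)"]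
    by (auto simp: J_def)
  have gc: "g (i, j) \<in> colours (xs ! j) (ys ! i)" if "i < s" "j < t" for i j
    using g(2)[of "(i, j)"] that by (simp add: J_def)
  have "x \<noteq> y" if xy: "x \<in> set xs" "y \<in> set ys" for x y
  proof -
    have "s * t \<le> card (colours x y)" using h[OF xy] by (simp add: heavy_def)
    then have "card (colours x y) > 0" using assms(1,2) by (meson less_le_trans mult_pos_pos)
    then have "colours x y \<noteq> {}" by auto
    then show ?thesis using colours_edges(3) by blast
  qed
  then show ?thesis
    using assms(1-6) g(1) colours_edges[OF gc]
    by (intro contains_subdivI[OF fin, of ys s xs t g]) (auto simp: J_def)
qed

text \<open>The Kovari-Sos-Turan argument inside one block: otherwise the heavy pairs would be dense
  enough to contain a biclique with parts of sizes \<open>s\<close> and \<open>t\<close>, contrary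
  to \<open>heavy_biclique_contains\<close>.\<close>

lemma heavy_pairs_le:
  assumes no: "\<not> contains_copy G (subdiv s t)" and st: "s > 0" "t > 0"
    and D: "4 * s \<le> D" "t * 4 ^ s \<le> D" and e: "(c, e) \<in> B"
  shows "2 * (\<Sum>x\<in>e. card {y \<in> e. x \<noteq> y \<and> heavy (s * t) x y}) \<le> D ^ 2"
proof (rule ccontr)
  define A where "A x = {y \<in> e. x \<noteq> y \<and> heavy (s * t) x y}" for x
  assume "\<not> ?thesis"
  then have "D ^ 2 < 2 * (\<Sum>x\<in>e. card (A x))" by (simp add: A_def)
  then have "real (D ^ 2) < real (2 * (\<Sum>x\<in>e. card (A x)))" by (rule less_imp_of_nat_less)
  then have big: "real D * real D \<le> 2 * (\<Sum>x\<in>e. real (card (A x)))"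
    by (simp add: power2_eq_square)
  have fe: "finite e" "card e = D" "e \<noteq> {}"
    using finite_block[OF e] block_card[OF e] D_pos by auto
  \<comment> \<open>The star count is applied with every vertex as its own colour, so that
    \<open>q = 1\<close> and rainbow lists are the distinct ones, and with \<open>b = D / 4\<close>.
    Half of \<open>D\<close> as average degree leaves room for \<open>s\<close> because
    \<open>4 * s \<le> D\<close>.\<close>
  have "(real s * real 1 + real D / 4) * real (card e) \<le> (real D / 2) * real (card e)"
    using D(1) by (intro mult_right_mono) auto
  also have "\<dots> \<le> (\<Sum>x\<in>e. real (card (A x)))" using big fe by simp
  finally obtain ys where ys: "length ys = s"
    "(real D / 4) ^ s * real (card e)
      \<le> real (card {x \<in> e. set ys \<subseteq> A x \<and> distinct (map (\<lambda>y. y) ys)}) * real (card e) ^ s"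
  proof (rule popular_rainbow_list[where Y = e and \<gamma> = "\<lambda>_ y. y", rotated -2])
    show "card {y \<in> A x. y = z} \<le> 1" for x z
      using card_mono[of "{z}" "{y \<in> A x. y = z}"] by auto
  qed (use fe D_pos in \<open>auto simp: A_def\<close>)
  define X where "X = {x \<in> e. set ys \<subseteq> A x \<and> distinct ys}"
  have "real D ^ s * (real D / 4 ^ s) \<le> real D ^ s * real (card X)"
    using ys(2) fe by (simp add: X_def power_divide mult.commute)
  then have "real D / 4 ^ s \<le> real (card X)"
    using D_pos by (subst (asm) mult_le_cancel_left_pos) auto
  moreover have "real t \<le> real D / 4 ^ s"
    using D(2) by (simp add: pos_le_divide_eq) (metis of_nat_le_iff of_nat_mult of_nat_numeral of_nat_power)
  ultimately have "t \<le> card X" by linarith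
  then obtain T where T: "T \<subseteq> X" "card T = t" "finite T"
    by (metis obtain_subset_with_card_n)
  then obtain xs where xs: "set xs = T" "distinct xs" "length xs = t"
    by (metis finite_distinct_list distinct_card)
  have "X \<noteq> {}" using T st by auto
  then have "distinct ys" by (auto simp: X_def)
  moreover have "heavy (s * t) x y" if "x \<in> set xs" "y \<in> set ys" for x y
    using that T(1) xs(1) by (auto simp: X_def A_def)
  ultimately show False
    using heavy_biclique_contains[OF st ys(1) xs(3) _ xs(2)] no by blast
qed

text \<open>Incidences between blocks and ordered light pairs are counted twice. A block contains at
  least \<open>D ^ 2 / 4\<close> such pairs, since at most half of \<open>D ^ 2\<close> are heavy,
  while a light pair lies in as many blocks as it has colours, which is less than
  \<open>s * t\<close>.\<close>

lemma light_pairs_ge: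
  assumes no: "\<not> contains_copy G (subdiv s t)" and st: "s > 0" "t > 0"
    and D: "4 * s \<le> D" "t * 4 ^ s \<le> D"
  shows "card B * D ^ 2 \<le> 4 * (s * t) * (\<Sum>x\<in>left_side G. card {y. light (s * t) x y})"
proof -
  define U where "U = left_side G"
  define P where "P = {q \<in> U \<times> U. light (s * t) (fst q) (snd q)}"
  have lightU: "x \<in> U \<and> y \<in> U \<and> x \<noteq> y" if "light m x y" for m x y
    using that colours_edges edges_sub unfolding light_def U_def by blast
  have "D ^ 2 \<le> 4 * card {q \<in> P. fst q \<in> e \<and> snd q \<in> e}" if e: "(c, e) \<in> B" for c e
  proof -
    have fe: "finite e" "card e = D" "e \<subseteq> U"
      using finite_block[OF e] block_card[OF e] block_sub[OF e] by (auto simp: U_def)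
    have col: "colours x y \<noteq> {}" if "x \<in> e" "y \<in> e" "x \<noteq> y" for x y
      using e that by (auto simp: colours_def)
    have "card {y \<in> e. light (s * t) x y} + card {y \<in> e. x \<noteq> y \<and> heavy (s * t) x y} = D - 1"
      if x: "x \<in> e" for x
    proof -
      have lh: "light (s * t) x y \<longleftrightarrow> x \<noteq> y \<and> \<not> heavy (s * t) x y" if "y \<in> e" for y
        using col[OF x that] lightU[of "s * t" x y] unfolding light_def by blast
      have "{y \<in> e. light (s * t) x y} \<union> {y \<in> e. x \<noteq> y \<and> heavy (s * t) x y} = e - {x}"
        using lh by blast
      moreover have "{y \<in> e. light (s * t) x y} \<inter> {y \<in> e. x \<noteq> y \<and> heavy (s * t) x y} = {}"
        by (auto simp: light_def)
      ultimately show ?thesis using fe x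
        by (subst card_Un_disjoint[symmetric]) auto
    qed
    then have "(\<Sum>x\<in>e. card {y \<in> e. light (s * t) x y})
        + (\<Sum>x\<in>e. card {y \<in> e. x \<noteq> y \<and> heavy (s * t) x y}) = D * (D - 1)"
      unfolding sum.distrib[symmetric] using fe(2) by simp
    moreover have "(\<Sum>x\<in>e. card {y \<in> e. light (s * t) x y})
        = card {q \<in> P. fst q \<in> e \<and> snd q \<in> e}"
    proof -
      have "{q \<in> P. fst q \<in> e \<and> snd q \<in> e} = (SIGMA x:e. {y \<in> e. light (s * t) x y})"
        using fe(3) by (auto simp: P_def)
      then show ?thesis using fe(1) by simp
    qed
    moreover note heavy_pairs_le[OF no st D e]
    \<comment> \<open>This turns \<open>D * (D - 1) - D ^ 2 / 2\<close> into at least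
      \<open>D ^ 2 / 4\<close>.\<close>
    moreover have "4 * D \<le> D * D"
    proof (rule mult_right_mono)
      show "4 \<le> D" using D(1) st(1) by linarith
    qed simp
    moreover have "D * (D - 1) = D * D - D" by (simp add: algebra_simps)
    ultimately show ?thesis unfolding power2_eq_square by linarith
  qed
  then have "(\<Sum>p\<in>B. D ^ 2) \<le> (\<Sum>p\<in>B. 4 * card {q \<in> P. fst q \<in> snd p \<and> snd q \<in> snd p})"
    by (intro sum_mono) auto
  also have "\<dots> = 4 * (\<Sum>p\<in>B. card {q \<in> P. fst q \<in> snd p \<and> snd q \<in> snd p})"
    by (simp add: sum_distrib_left)
  also have "(\<Sum>p\<in>B. card {q \<in> P. fst q \<in> snd p \<and> snd q \<in> snd p})
      = (\<Sum>q\<in>P. card {p \<in> B. fst q \<in> snd p \<and> snd q \<in> snd p})"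
    by (intro sum_multicount_gen finite_B) (auto simp: P_def U_def)
  also have "\<dots> = (\<Sum>q\<in>P. card (colours (fst q) (snd q)))"
    using card_colours lightU by (intro sum.cong) (auto simp: P_def)
  also have "\<dots> \<le> (\<Sum>q\<in>P. s * t)" by (intro sum_mono) (auto simp: P_def light_def heavy_def)
  also have "\<dots> = s * t * card P" by simp
  also have "card P = (\<Sum>x\<in>U. card {y. light (s * t) x y})"
  proof -
    have "finite {y. light (s * t) x y}" for x
      by (rule finite_subset[of _ U]) (use lightU in \<open>auto simp: U_def\<close>)
    moreover have "P = (SIGMA x:U. {y. light (s * t) x y})" using lightU by (auto simp: P_def)
    ultimately show ?thesis by (simp add: U_def)
  qed
  finally show ?thesis by (simp add: U_def algebra_simps)
qed

text \<open>Without a copy, assumption \<open>B\<close> pushes the average light degree up to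
  \<open>s * D + b\<close>, and by \<open>K\<close> some list of \<open>s\<close> leaves has at
  least \<open>t * (s * s * D)\<close> centres whose stars are rainbow. Each centre shares a chosen
  colour with at most \<open>s * s * D\<close> of them, so greedy selection finds \<open>t\<close>
  centres with disjoint colour sets. These and the leaves form a copy.\<close>

lemma contains_of_many_blocks:
  assumes st: "s > 0" "t > 0" and D: "4 * s \<le> D" "t * 4 ^ s \<le> D"
    and n: "left_side G \<noteq> {}" and b: "b > 0"
    and B: "4 * real (s * t) * (real s * real D + b) * real (card (left_side G))
      \<le> real (card B) * (real D)\<^sup>2"
    and K: "real (t * (s * s * D)) * real (card (left_side G)) ^ s
      \<le> b ^ s * real (card (left_side G))"
  shows "contains_copy G (subdiv s t)"
proof (rule ccontr)
  assume no: "\<not> contains_copy G (subdiv s t)"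
  define U where "U = left_side G"
  define A where "A x = {y. light (s * t) x y}" for x
  \<comment> \<open>The chosen colour will be the right vertex that subdivides the pair. On light
    pairs the colour set is nonempty, so the choice is meaningful there.\<close>
  define \<gamma> where "\<gamma> x y = (SOME c. c \<in> colours x y)" for x y
  have \<gamma>: "\<gamma> x y \<in> colours x y" if "y \<in> A x" for x y
  proof -
    have "colours x y \<noteq> {}" using that by (simp add: A_def light_def)
    then show ?thesis unfolding \<gamma>_def by (rule some_in_eq[THEN iffD2])
  qed
  have AU: "A x \<subseteq> U" for x
    using colours_edges(2)[OF \<gamma>] edges_sub unfolding U_def by blast
  have "real (card B * D ^ 2) \<le> real (4 * (s * t) * (\<Sum>x\<in>U. card (A x)))"
    using light_pairs_ge[OF no st D] unfolding U_def A_def of_nat_le_iff .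
  then have "4 * real (s * t) * ((real s * real D + b) * real (card U))
      \<le> 4 * real (s * t) * (\<Sum>x\<in>U. real (card (A x)))"
    using B by (simp add: U_def mult.assoc)
  then have *: "(real s * real D + b) * real (card U) \<le> (\<Sum>x\<in>U. real (card (A x)))"
    using st by simp
  obtain ys where ys: "length ys = s"
    "b ^ s * real (card U)
      \<le> real (card {x \<in> U. set ys \<subseteq> A x \<and> distinct (map (\<gamma> x) ys)}) * real (card U) ^ s"
  proof (rule popular_rainbow_list[OF _ _ _ _ _ b *, where Y = U])
    show "card {y \<in> A x. \<gamma> x y = c} \<le> D" for x c
    proof -
      have "{y \<in> A x. \<gamma> x y = c} \<subseteq> {y. c \<in> colours x y}" using \<gamma> by auto
      then have "card {y \<in> A x. \<gamma> x y = c} \<le> card {y. c \<in> colours x y}"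
        using colour_fibre by (intro card_mono) auto
      then show ?thesis using colour_fibre[of c x] by linarith
    qed
  qed (use n AU in \<open>auto simp: U_def\<close>)
  define X where "X = {x \<in> U. set ys \<subseteq> A x \<and> distinct (map (\<gamma> x) ys)}"
  define conf where "conf x x' \<longleftrightarrow> \<gamma> x ` set ys \<inter> \<gamma> x' ` set ys \<noteq> {}" for x x'
  have "finite X" by (simp add: X_def U_def)
  have ysne: "set ys \<noteq> {}" using ys(1) st by auto
  have cy: "card (set ys) \<le> s" using card_length[of ys] ys(1) by simp
  have "card U > 0" using n by (simp add: U_def card_gt_0_iff)
  then have "real (card U) ^ s > 0" by simp
  moreover have "real (t * (s * s * D)) * real (card U) ^ s \<le> real (card X) * real (card U) ^ s"
    using K ys(2) unfolding X_def[symmetric] U_def[symmetric] by linarith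
  ultimately have "real (t * (s * s * D)) \<le> real (card X)" by (rule mult_right_le_imp_le[rotated])
  then have cX: "t * (s * s * D) \<le> card X" by (simp only: of_nat_le_iff)
  obtain T where T: "T \<subseteq> X" "card T = t" "\<And>x y. x \<in> T \<Longrightarrow> y \<in> T \<Longrightarrow> x \<noteq> y \<Longrightarrow> \<not> conf x y"
  proof (rule independent_subset[OF \<open>finite X\<close> _ _ _ cX])
    fix x assume x: "x \<in> X"
    \<comment> \<open>A conflict \<open>\<gamma> x y = \<gamma> x' y'\<close> means that
      \<open>x'\<close> shares the colour \<open>\<gamma> x y\<close> with the leaf
      \<open>y'\<close>. For each pair \<open>(y, y')\<close> of leaves, \<open>colour_fibre\<close>
      allows at most \<open>D\<close> such \<open>x'\<close>.\<close>
    define F where "F p = {x'. \<gamma> x (fst p) \<in> colours (snd p) x'}" for p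
    have F: "finite (F p)" "card (F p) \<le> D" for p using colour_fibre by (simp_all add: F_def)
    have "{x' \<in> X. conf x x'} \<subseteq> (\<Union>p \<in> set ys \<times> set ys. F p)"
    proof
      fix x' assume "x' \<in> {x' \<in> X. conf x x'}"
      then obtain y y' where y: "y \<in> set ys" "y' \<in> set ys" "\<gamma> x y = \<gamma> x' y'" "x' \<in> X"
        unfolding conf_def by blast
      then have "y' \<in> A x'" by (auto simp: X_def)
      then have "\<gamma> x y \<in> colours y' x'" using \<gamma>[of y' x'] y(3) colours_commute[of x' y'] by simp
      then show "x' \<in> (\<Union>p \<in> set ys \<times> set ys. F p)"
        using y by (intro UN_I[of "(y, y')"]) (auto simp: F_def)
    qed
    then have "card {x' \<in> X. conf x x'}
        \<le> card (\<Union>p \<in> set ys \<times> set ys. F p)"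
      using F by (intro card_mono) auto
    also have "\<dots> \<le> (\<Sum>p \<in> set ys \<times> set ys. card (F p))"
      using card_UN_le[of "set ys \<times> set ys" F] by simp
    also have "\<dots> \<le> card (set ys \<times> set ys) * D"
      using sum_bounded_above[of "set ys \<times> set ys" "\<lambda>p. card (F p)" D]
        F by simp
    also have "\<dots> \<le> s * s * D"
      using cy by (simp add: card_cartesian_product mult_mono)
    finally show "card {x' \<in> X. conf x x'} \<le> s * s * D" .
  qed (use st D_pos ysne in \<open>auto simp: conf_def\<close>)
  have "finite T" using T(1) \<open>finite X\<close> by (rule finite_subset)
  then obtain xs where xs: "set xs = T" "distinct xs" "length xs = t"
    using T(2) by (metis finite_distinct_list distinct_card)
  define g where "g = (\<lambda>(i, j). \<gamma> (xs ! j) (ys ! i))"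
  have xsX: "xs ! j \<in> X" if "j < t" for j using that xs T(1) nth_mem by blast
  have dist: "distinct (map (\<gamma> (xs ! j)) ys)" if "j < t" for j
    using xsX[OF that] by (simp add: X_def)
  have col: "g (i, j) \<in> colours (xs ! j) (ys ! i)" if "i < s" "j < t" for i j
  proof -
    have "ys ! i \<in> A (xs ! j)" using xsX[OF that(2)] nth_mem[of i ys] that(1) ys(1) unfolding X_def by blast
    then show ?thesis using \<gamma> by (simp add: g_def)
  qed
  have "distinct ys" using dist[OF st(2)] by (simp add: distinct_map)
  \<comment> \<open>Equal colours at different centres would be a conflict, and equal colours at one
    centre contradict that its star is rainbow.\<close>
  moreover have "inj_on g ({..<s} \<times> {..<t})"
  proof (rule inj_onI)
    fix p p' assume p: "p \<in> {..<s} \<times> {..<t}" "p' \<in> {..<s} \<times> {..<t}" "g p = g p'"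
    obtain i j i' j' where [simp]: "p = (i, j)" "p' = (i', j')" by (cases p; cases p')
    have ij: "i < s" "j < t" "i' < s" "j' < t" using p by auto
    have "conf (xs ! j) (xs ! j')"
    proof -
      have "\<gamma> (xs ! j) (ys ! i) = \<gamma> (xs ! j') (ys ! i')" using p(3) by (simp add: g_def)
      moreover have "ys ! i \<in> set ys" "ys ! i' \<in> set ys" using ij ys(1) by simp_all
      ultimately show ?thesis unfolding conf_def by (metis IntI empty_iff imageI)
    qed
    then have "xs ! j = xs ! j'" using T(3) xs ij nth_mem by blast
    then have "j = j'" using xs ij by (simp add: nth_eq_iff_index_eq)
    moreover from this have "map (\<gamma> (xs ! j)) ys ! i = map (\<gamma> (xs ! j)) ys ! i'"
      using p(3) ij ys(1) by (simp add: g_def)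
    then have "i = i'" using dist[OF ij(2)] ij ys(1) by (metis length_map nth_eq_iff_index_eq)
    ultimately show "p = p'" by simp
  qed
  moreover have "set ys \<inter> set xs = {}"
  proof -
    have "y \<noteq> x" if "y \<in> set ys" "x \<in> set xs" for x y
    proof -
      have "y \<in> A x" using that T(1) xs(1) by (auto simp: X_def)
      then show ?thesis using colours_edges(3)[OF \<gamma>] by blast
    qed
    then show ?thesis by blast
  qed
  ultimately have "contains_copy G (subdiv s t)"
    using st ys(1) xs colours_edges[OF col]
    by (intro contains_subdivI[OF fin, of ys s xs t g]) auto
  then show False using no by simp
qed

end

section \<open>The upper bound at exponent \<open>2 - 1 / s\<close>\<close>

text \<open>Cutting a neighbourhood into blocks leaves fewer than \<open>D\<close> edges over at
  each right vertex. The factor 2 pays for this loss and still leaves an average of one block per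
  right vertex.\<close>

lemma exists_block_system:
  assumes fin: "finite_bigraph G" and "D > 0"
    and E: "2 * D * card (right_side G) \<le> card (edges G)"
  obtains B where "block_system G B D" "card (right_side G) \<le> card B"
proof -
  define N where "N v = {u. (u, v) \<in> edges G}" for v
  have sub: "edges G \<subseteq> left_side G \<times> right_side G" and fs: "finite (left_side G)" "finite (right_side G)"
    using fin by (auto simp: finite_bigraph_def)
  have finN: "finite (N v)" for v
    by (rule finite_subset[OF _ fs(1)]) (use sub in \<open>auto simp: N_def\<close>)
  have "\<exists>P. finite P \<and> card P = card (N v) div D \<and> (\<forall>e\<in>P. e \<subseteq> N v \<and> card e = D) \<and>
      (\<forall>e\<in>P. \<forall>e'\<in>P. e \<noteq> e' \<longrightarrow> e \<inter> e' = {})" for v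
    using disjoint_blocks[OF finN[of v] \<open>D > 0\<close>] by metis
  then obtain P where P: "\<And>v. finite (P v)" "\<And>v. card (P v) = card (N v) div D"
    "\<And>v e. e \<in> P v \<Longrightarrow> e \<subseteq> N v \<and> card e = D"
    "\<And>v e e'. e \<in> P v \<Longrightarrow> e' \<in> P v \<Longrightarrow> e \<noteq> e' \<Longrightarrow> e \<inter> e' = {}"
    by metis
  define B where "B = (SIGMA v : right_side G. P v)"
  have "block_system G B D"
  proof
    show "(x, c) \<in> edges G" if "(c, e) \<in> B" "x \<in> e" for c e x
      using that P(3)[of e c] by (auto simp: B_def N_def)
    show "e = e'" if "(c, e) \<in> B" "(c, e') \<in> B" "x \<in> e" "x \<in> e'" for c e e' x
      using that P(4)[of e c e'] by (auto simp: B_def)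
  qed (use fin \<open>D > 0\<close> P(3) in \<open>auto simp: B_def\<close>)
  moreover have "card (right_side G) \<le> card B"
  proof -
    have "edges G = prod.swap ` (SIGMA v : right_side G. N v)"
      using sub by (force simp: N_def image_iff)
    then have "card (edges G) = (\<Sum>v\<in>right_side G. card (N v))"
      using fs(2) finN by (simp add: card_image)
    also have "\<dots> \<le> (\<Sum>v\<in>right_side G. D * card (P v) + D)"
    proof (rule sum_mono)
      fix v
      have "card (N v) mod D \<le> D" using \<open>D > 0\<close> by (simp add: less_imp_le)
      then show "card (N v) \<le> D * card (P v) + D"
        using mult_div_mod_eq[of D "card (N v)"] unfolding P(2) by linarith
    qed
    also have "\<dots> = D * card B + D * card (right_side G)"
      using fs(2) P(1) by (simp add: B_def sum.distrib sum_distrib_left mult.commute)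
    finally have "D * card (right_side G) \<le> D * card B" using E by linarith
    then show ?thesis using \<open>D > 0\<close> by simp
  qed
  ultimately show ?thesis using that by blast
qed

lemma linearly_forced_subdiv:
  assumes st: "s > 0" "t > 0"
  shows "linearly_forced (subdiv s t) (2 - 1 / real s)"
  unfolding linearly_forced_def
proof (intro allI impI)
  fix \<epsilon> :: real assume e: "\<epsilon> > 0"
  \<comment> \<open>The bound is \<open>t * s ^ 2 * D \<le> \<epsilon> * D ^ 2 / (8 * s * t)\<close>
    solved for \<open>D\<close>; the fact \<open>base\<close> recovers it.\<close>
  obtain D0 :: nat where D0: "8 * real s ^ 3 * real t ^ 2 / \<epsilon> \<le> real D0"
    using real_arch_simple by blast
  define D where "D = D0 + 4 * s + t * 4 ^ s"
  have D: "4 * s \<le> D" "t * 4 ^ s \<le> D" "D > 0" using st by (auto simp: D_def)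
  have "8 * real s ^ 3 * real t ^ 2 / \<epsilon> \<le> real D"
  proof -
    have "real D0 \<le> real D" unfolding of_nat_le_iff by (simp add: D_def)
    then show ?thesis using D0 by linarith
  qed
  then have De: "8 * real s ^ 3 * real t ^ 2 \<le> \<epsilon> * real D" using e
    by (simp only: pos_divide_le_eq mult.commute)
  show "\<exists>\<delta>. \<forall>G :: (nat, nat) bigraph. finite_bigraph G \<and> (left_side G \<noteq> {} \<or> right_side G \<noteq> {}) \<and>
    real (card (right_side G)) \<ge> \<epsilon> * real (card (left_side G)) powr (2 - 1 / real s) \<and>
    real (card (edges G)) \<ge> \<delta> * real (card (right_side G)) \<longrightarrow> contains_copy G (subdiv s t)"
  proof (intro exI[of _ "real (2 * D)"] allI impI, elim conjE)
    fix G :: "(nat, nat) bigraph"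
    assume G: "finite_bigraph G" "left_side G \<noteq> {} \<or> right_side G \<noteq> {}"
      and V: "real (card (right_side G)) \<ge> \<epsilon> * real (card (left_side G)) powr (2 - 1 / real s)"
      and E: "real (card (edges G)) \<ge> real (2 * D) * real (card (right_side G))"
    have fs: "finite (left_side G)" "finite (right_side G)" "edges G \<subseteq> left_side G \<times> right_side G"
      using G(1) by (auto simp: finite_bigraph_def)
    define n where "n = card (left_side G)"
    have "left_side G \<noteq> {}"
    proof
      assume "left_side G = {}"
      then have "edges G = {}" "card (right_side G) > 0" using G(2) fs by (auto simp: card_gt_0_iff)
      then have "real (2 * D) * real (card (right_side G)) > 0" using D(3) by (intro mult_pos_pos) auto
      then show False using E \<open>edges G = {}\<close> by simp
    qed
    then have n: "n > 0" using fs(1) by (simp add: n_def card_gt_0_iff)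
    have "2 * D * card (right_side G) \<le> card (edges G)"
      using E unfolding of_nat_mult[symmetric] of_nat_le_iff .
    then obtain B where B: "block_system G B D" "card (right_side G) \<le> card B"
      using exists_block_system[OF G(1) D(3)] by blast
    define m where "m = real n powr (1 - 1 / real s)"
    \<comment> \<open>There are at least \<open>\<epsilon> * m * n\<close> blocks, and
      \<open>b\<close> solves \<open>4 * (s * t) * (2 * b) * n = \<epsilon> * m * n * D ^ 2\<close>.
      The doubled \<open>b\<close> covers \<open>s * D + b\<close>, because \<open>base\<close>
      gives \<open>s * D \<le> b\<close>.\<close>
    define b where "b = \<epsilon> * real D ^ 2 * m / (8 * real (s * t))"
    have "real n \<ge> 1" "1 - 1 / real s \<ge> 0" using n st by auto
    then have m1: "m \<ge> 1" unfolding m_def by (rule ge_one_powr_ge_zero)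
    have "real n powr (2 - 1 / real s) = real n powr (1 + (1 - 1 / real s))" by simp
    also have "\<dots> = real n powr 1 * real n powr (1 - 1 / real s)" by (rule powr_add)
    also have "\<dots> = m * real n" using n by (simp add: m_def)
    finally have nm: "real n powr (2 - 1 / real s) = m * real n" .
    have cB: "\<epsilon> * (m * real n) \<le> real (card B)"
      using V[folded n_def, unfolded nm] B(2) by linarith
    \<comment> \<open>The exponent \<open>2 - 1 / s\<close> is calibrated for this identity: the
      powers of \<open>n\<close> on the two sides of the star count balance, and only constants
      remain to be compared.\<close>
    have ms: "m ^ s * real n = real n ^ s"
    proof -
      have "m ^ s = real n powr (real s * (1 - 1 / real s))" using n by (simp add: m_def powr_power)
      then have "m ^ s * real n = real n powr (real s * (1 - 1 / real s)) * real n powr 1"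
        using n by simp
      also have "\<dots> = real n powr (real s * (1 - 1 / real s) + 1)" by (rule powr_add[symmetric])
      also have "real s * (1 - 1 / real s) + 1 = real s" using st by (simp add: right_diff_distrib)
      finally show ?thesis using n by (simp add: powr_realpow)
    qed
    have base: "real (t * (s * s * D)) \<le> \<epsilon> * real D ^ 2 / (8 * real (s * t))"
    proof -
      have "8 * real s ^ 3 * real t ^ 2 * real D \<le> \<epsilon> * real D * real D"
        using De by (intro mult_right_mono) auto
      then have "real (t * (s * s * D)) * (8 * real (s * t)) \<le> \<epsilon> * real D ^ 2"
        by (simp add: power2_eq_square power3_eq_cube ac_simps)
      then show ?thesis using st by (subst pos_le_divide_eq) auto
    qed
    have ge1: "1 \<le> t * (s * s * D)" using st D(3) by (simp add: Suc_le_eq)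
    show "contains_copy G (subdiv s t)"
    proof (rule block_system.contains_of_many_blocks[OF B(1) st D(1,2) \<open>left_side G \<noteq> {}\<close>])
      show "b > 0" using e D(3) m1 st by (simp add: b_def)
      have "real s * real D \<le> real (t * (s * s * D))"
      proof -
        have "s * D * 1 \<le> s * D * (t * s)" using st by (intro mult_left_mono) (auto simp: Suc_le_eq)
        then have "real (s * D) \<le> real (t * (s * s * D))" unfolding of_nat_le_iff by (simp add: ac_simps)
        then show ?thesis by simp
      qed
      also have "\<dots> \<le> \<epsilon> * real D ^ 2 / (8 * real (s * t))" by (rule base)
      also have "\<dots> \<le> b"
        using mult_left_mono[OF m1, of "\<epsilon> * real D ^ 2 / (8 * real (s * t))"] e by (simp add: b_def)
      finally have "real s * real D + b \<le> 2 * b" by simp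
      then have "4 * real (s * t) * (real s * real D + b) * real n \<le> 4 * real (s * t) * (2 * b) * real n"
        by (intro mult_right_mono mult_left_mono) auto
      also have "\<dots> = \<epsilon> * (m * real n) * (real D)\<^sup>2" using st by (simp add: b_def)
      also have "\<dots> \<le> real (card B) * (real D)\<^sup>2" using cB by (intro mult_right_mono) auto
      finally show "4 * real (s * t) * (real s * real D + b) * real (card (left_side G))
        \<le> real (card B) * (real D)\<^sup>2" by (simp add: n_def)
      \<comment> \<open>The constant is at least 1, so it may be raised to the power
        \<open>s\<close> that occurs in \<open>b ^ s\<close>.\<close>
      have "real (t * (s * s * D)) \<le> real (t * (s * s * D)) ^ s"
        using ge1 st by (intro self_le_power) (auto simp del: of_nat_mult)
      also have "\<dots> \<le> (\<epsilon> * real D ^ 2 / (8 * real (s * t))) ^ s"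
        using base by (intro power_mono) auto
      finally have "real (t * (s * s * D)) * real n ^ s
          \<le> (\<epsilon> * real D ^ 2 / (8 * real (s * t))) ^ s * (m ^ s * real n)"
        unfolding ms by (intro mult_right_mono) auto
      also have "\<dots> = b ^ s * real n" by (simp add: b_def power_mult_distrib power_divide)
      finally show "real (t * (s * s * D)) * real (card (left_side G)) ^ s
        \<le> b ^ s * real (card (left_side G))" by (simp add: n_def)
    qed
  qed
qed

subsection \<open>Lower bound\<close>

text \<open>Independence without division: the assumption says that one of \<open>c\<close> equally
  likely values falls into \<open>W i\<close> with probability at most \<open>1 / w i\<close>, and
  these probabilities multiply.\<close>

lemma card_PiE_mult_le:
  fixes w :: "'a \<Rightarrow> nat"
  assumes "finite I" "\<And>i. i \<in> I \<Longrightarrow> card (W i) * w i \<le> c"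
  shows "card (PiE I W) * prod w I \<le> c ^ card I"
proof -
  have "card (PiE I W) * prod w I = (\<Prod>i\<in>I. card (W i) * w i)"
    using assms(1) by (simp add: card_PiE prod.distrib)
  also have "\<dots> \<le> (\<Prod>i\<in>I. c)" using assms(2) by (intro prod_mono) auto
  finally show ?thesis by simp
qed

lemma prod_indicator_power:
  fixes c :: nat
  assumes "finite I" "S \<subseteq> I"
  shows "(\<Prod>i\<in>I. if i \<in> S then c else 1) = c ^ card S"
proof -
  have "(\<Prod>i\<in>I. if i \<in> S then c else 1) = (\<Prod>i\<in>S. c)"
    using assms by (intro prod.mono_neutral_cong_right) auto
  then show ?thesis by simp
qed

text \<open>The function \<open>\<tau>\<close> encodes the neighbourhood of a random right vertex,
  one vertex per class. Two given left vertices are both adjacent to it with probability at most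
  \<open>1 / n ^ 2\<close>: this never happens within one class, and different classes are
  independent.\<close>

lemma card_two_values_fixed:
  assumes "p \<noteq> q" "fst p < d" "fst q < d"
  shows "card {\<tau> \<in> {..<d} \<rightarrow>\<^sub>E {..<n}. \<tau> (fst p) = snd p \<and> \<tau> (fst q) = snd q} * n ^ 2 \<le> n ^ d"
proof (cases "fst p = fst q")
  case True
  then have "snd p \<noteq> snd q" using assms(1) by (simp add: prod_eq_iff)
  then have "{\<tau> \<in> {..<d} \<rightarrow>\<^sub>E {..<n}. \<tau> (fst p) = snd p \<and> \<tau> (fst q) = snd q} = {}"
    using True by auto
  then show ?thesis by (simp only: card.empty)
next
  case False
  define W where "W k = (if k = fst p then {snd p} else if k = fst q then {snd q} else {..<n})" for k
  define w where "w k = (if k \<in> {fst p, fst q} then n else 1)" for k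
  have "{\<tau> \<in> {..<d} \<rightarrow>\<^sub>E {..<n}. \<tau> (fst p) = snd p \<and> \<tau> (fst q) = snd q} \<subseteq> PiE {..<d} W"
    by (auto simp: W_def PiE_def extensional_def)
  moreover have "finite (PiE {..<d} W)" by (intro finite_PiE) (auto simp: W_def)
  ultimately have "card {\<tau> \<in> {..<d} \<rightarrow>\<^sub>E {..<n}. \<tau> (fst p) = snd p \<and> \<tau> (fst q) = snd q}
      \<le> card (PiE {..<d} W)"
    by (intro card_mono)
  then have "card {\<tau> \<in> {..<d} \<rightarrow>\<^sub>E {..<n}. \<tau> (fst p) = snd p \<and> \<tau> (fst q) = snd q} * prod w {..<d}
      \<le> card (PiE {..<d} W) * prod w {..<d}"
    by (rule mult_le_mono1)
  also have "\<dots> \<le> n ^ card {..<d}"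
    by (rule card_PiE_mult_le) (auto simp: W_def w_def)
  also have "prod w {..<d} = n ^ 2"
    unfolding w_def using assms False by (subst prod_indicator_power) (auto simp: power2_eq_square)
  finally show ?thesis by simp
qed

text \<open>First moment and deletion. The assumption says that the expected number of copies, at
  most \<open>(d * n) ^ (s + t) * M ^ (s * t) / n ^ (2 * (s * t))\<close>, does not exceed
  \<open>M / 2\<close>. Deleting one right vertex per copy keeps half of them, each still of degree
  \<open>d\<close>.\<close>

lemma exists_subdiv_free:
  fixes n d M s t :: nat
  assumes pos: "n > 0" "s > 0" "t > 0"
    and le: "2 * ((d * n) ^ (s + t) * M ^ (s * t)) \<le> M * n ^ (2 * (s * t))"
  obtains G :: "(nat \<times> nat, nat) bigraph" where "finite_bigraph G"
    "left_side G = {..<d} \<times> {..<n}" "M \<le> 2 * card (right_side G)"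
    "card (edges G) = d * card (right_side G)" "\<not> contains_copy G (subdiv s t)"
proof -
  define H where "H = subdiv s t"
  define LS RS where "LS = left_side H" and "RS = right_side H"
  define U where "U = {..<d} \<times> {..<n}"
  define T where "T = {..<d} \<rightarrow>\<^sub>E {..<n}"
  define \<Phi> where "\<Phi> = {..<M} \<rightarrow>\<^sub>E T"
  \<comment> \<open>Extensional functions keep the set of candidate maps finite. Injectivity is left
    to \<open>copy\<close>, which only makes the count of candidates more generous.\<close>
  define C where "C = (LS \<rightarrow>\<^sub>E U) \<times> (RS \<rightarrow>\<^sub>E {..<M})"
  define ok :: "(nat \<Rightarrow> nat \<Rightarrow> nat) \<Rightarrow> nat \<times> nat \<Rightarrow> nat \<Rightarrow> bool"
    where "ok \<phi> p v \<longleftrightarrow> \<phi> v (fst p) = snd p" for \<phi> p v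
  define copy where "copy \<phi> c \<longleftrightarrow> inj_on (fst c) LS \<and> inj_on (snd c) RS \<and>
      (\<forall>(i, j) \<in> RS. ok \<phi> (fst c (Inl i)) (snd c (i, j)) \<and> ok \<phi> (fst c (Inr j)) (snd c (i, j)))"
    for \<phi> and c :: "(nat + nat \<Rightarrow> nat \<times> nat) \<times> (nat \<times> nat \<Rightarrow> nat)"
  have RS: "RS = {1..s} \<times> {1..t}" and LS: "LS = {1..s} <+> {1..t}"
    by (simp_all add: RS_def LS_def H_def subdiv_def)
  have finLR: "finite LS" "finite RS" by (simp_all add: LS RS)
  have cT: "card T = n ^ d" and finT: "finite T" by (simp_all add: T_def card_PiE finite_PiE)
  have c\<Phi>: "card \<Phi> = (n ^ d) ^ M" and fin\<Phi>: "finite \<Phi>"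
    using finT by (simp_all add: \<Phi>_def card_PiE cT finite_PiE)
  have cC: "card C = (d * n) ^ (s + t) * M ^ (s * t)"
    using finLR by (simp add: C_def card_cartesian_product card_PiE U_def)
      (simp add: LS RS card_Plus card_cartesian_product)
  have finC: "finite C" using finLR by (simp add: C_def finite_PiE U_def)
  have count: "card {\<phi> \<in> \<Phi>. copy \<phi> c} * n ^ (2 * (s * t)) \<le> card \<Phi>" if c: "c \<in> C" for c
  proof (cases "inj_on (fst c) LS \<and> inj_on (snd c) RS")
    case False
    then have "{\<phi> \<in> \<Phi>. copy \<phi> c} = {}" by (auto simp: copy_def)
    then show ?thesis by (simp only: card.empty)
  next
    case True
    define f g where "f = fst c" and "g = snd c"
    have injs: "inj_on f LS" "inj_on g RS" using True by (simp_all add: f_def g_def)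
    have fU: "f a \<in> U" if "a \<in> LS" for a using c that by (auto simp: C_def f_def)
    have gM: "g ` RS \<subseteq> {..<M}" using c by (auto simp: C_def g_def)
    define A where "A b = {\<tau> \<in> T. \<tau> (fst (f (Inl (fst b)))) = snd (f (Inl (fst b))) \<and>
        \<tau> (fst (f (Inr (snd b)))) = snd (f (Inr (snd b)))}" for b
    have cA: "card (A b) * n ^ 2 \<le> n ^ d" if "b \<in> RS" for b
    proof -
      have b: "Inl (fst b) \<in> LS" "Inr (snd b) \<in> LS" using that by (auto simp: RS LS)
      then have "f (Inl (fst b)) \<noteq> f (Inr (snd b))" using inj_onD[OF injs(1) _ b] by auto
      moreover have "fst (f (Inl (fst b))) < d" "fst (f (Inr (snd b))) < d"
        using fU[OF b(1)] fU[OF b(2)] by (auto simp: U_def)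
      ultimately show ?thesis unfolding A_def T_def by (rule card_two_values_fixed)
    qed
    \<comment> \<open>Only right vertices used by the candidate are constrained. Since
      \<open>g\<close> is injective, each carries the constraint of a single \<open>b\<close>, so
      the constraints sit on separate coordinates of \<open>\<phi>\<close>.\<close>
    define W where "W v = (if v \<in> g ` RS then A (inv_into RS g v) else T)" for v
    define w where "w v = (if v \<in> g ` RS then n ^ 2 else 1)" for v
    have "{\<phi> \<in> \<Phi>. copy \<phi> c} \<subseteq> PiE {..<M} W"
    proof (intro subsetI PiE_I)
      fix \<phi> v assume \<phi>: "\<phi> \<in> {\<phi> \<in> \<Phi>. copy \<phi> c}"
      {
        assume v: "v \<in> {..<M}"
        have T: "\<phi> v \<in> T" using \<phi> v by (auto simp: \<Phi>_def)
        show "\<phi> v \<in> W v"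
        proof (cases "v \<in> g ` RS")
          case True
          then obtain i j where ij: "(i, j) \<in> RS" "v = g (i, j)" by auto
          then have "inv_into RS g v = (i, j)" using injs(2) by simp
          moreover have "ok \<phi> (f (Inl i)) v" "ok \<phi> (f (Inr j)) v"
            using \<phi> ij by (auto simp: copy_def f_def g_def)
          ultimately show ?thesis using True T by (simp add: W_def A_def ok_def)
        qed (use T in \<open>simp add: W_def\<close>)
      next
        assume "v \<notin> {..<M}"
        then show "\<phi> v = undefined" using \<phi> by (auto simp: \<Phi>_def)
      }
    qed
    moreover have "finite (PiE {..<M} W)" using finT by (intro finite_PiE) (auto simp: W_def A_def)
    ultimately have "card {\<phi> \<in> \<Phi>. copy \<phi> c} \<le> card (PiE {..<M} W)" by (intro card_mono)
    then have "card {\<phi> \<in> \<Phi>. copy \<phi> c} * prod w {..<M} \<le> card (PiE {..<M} W) * prod w {..<M}"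
      by (rule mult_le_mono1)
    also have "\<dots> \<le> (n ^ d) ^ card {..<M}"
    proof (rule card_PiE_mult_le)
      show "card (W v) * w v \<le> n ^ d" for v
        using cA[of "inv_into RS g v"] cT by (simp add: W_def w_def inv_into_into)
    qed simp
    also have "prod w {..<M} = (n ^ 2) ^ card RS"
      unfolding w_def using gM injs(2) by (subst prod_indicator_power) (auto simp: card_image)
    also have "(n ^ 2) ^ card RS = n ^ (2 * (s * t))"
      by (simp add: RS card_cartesian_product power_mult)
    finally show ?thesis by (simp add: c\<Phi>)
  qed
  define N where "N = n ^ (2 * (s * t))"
  have "N > 0" using pos by (simp add: N_def)
  \<comment> \<open>Averaging over all \<open>\<phi>\<close>, with both sides scaled by
    \<open>N\<close> to stay in the natural numbers.\<close>
  have "\<exists>\<phi>\<in>\<Phi>. 2 * card {c \<in> C. copy \<phi> c} \<le> M"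
  proof (rule ccontr)
    assume "\<not> ?thesis"
    moreover have "\<Phi> \<noteq> {}" using c\<Phi> pos by auto
    ultimately have "(\<Sum>\<phi>\<in>\<Phi>. M * N) < (\<Sum>\<phi>\<in>\<Phi>. 2 * card {c \<in> C. copy \<phi> c} * N)"
      using fin\<Phi> \<open>N > 0\<close> by (intro sum_strict_mono) (auto simp: not_le)
    also have "\<dots> = 2 * ((\<Sum>\<phi>\<in>\<Phi>. card {c \<in> C. copy \<phi> c}) * N)"
      by (simp add: sum_distrib_left sum_distrib_right mult.assoc)
    also have "(\<Sum>\<phi>\<in>\<Phi>. card {c \<in> C. copy \<phi> c}) = (\<Sum>c\<in>C. card {\<phi> \<in> \<Phi>. copy \<phi> c})"
      by (rule sum_multicount_gen) (use finC fin\<Phi> in auto)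
    also have "2 * ((\<Sum>c\<in>C. card {\<phi> \<in> \<Phi>. copy \<phi> c}) * N) \<le> 2 * (\<Sum>c\<in>C. card \<Phi>)"
      using count by (simp only: sum_distrib_right N_def) (intro mult_left_mono sum_mono, auto)
    also have "\<dots> = 2 * card C * card \<Phi>" by simp
    also have "\<dots> \<le> M * N * card \<Phi>" using le unfolding cC N_def by (intro mult_right_mono) auto
    finally show False by simp
  qed
  then obtain \<phi> where \<phi>: "\<phi> \<in> \<Phi>" "2 * card {c \<in> C. copy \<phi> c} \<le> M" by blast
  \<comment> \<open>The vertex deleted from each copy is the image of the right vertex
    \<open>(1, 1)\<close>, which exists because \<open>s\<close> and \<open>t\<close> are
    positive.\<close>
  define Bad where "Bad = (\<lambda>c. snd c (1, 1)) ` {c \<in> C. copy \<phi> c}"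
  define V where "V = {..<M} - Bad"
  define G where "G = \<lparr>left_side = U, right_side = V,
    edges = (\<lambda>(v, k). ((k, \<phi> v k), v)) ` (V \<times> {..<d})\<rparr>"
  have \<phi>n: "\<phi> v k < n" if "v < M" "k < d" for v k
    using \<phi>(1) that by (auto simp: \<Phi>_def T_def PiE_iff)
  have finV: "finite V" by (simp add: V_def)
  have "card Bad \<le> card {c \<in> C. copy \<phi> c}" using finC by (simp add: Bad_def card_image_le)
  moreover have "M - card Bad \<le> card V"
    using diff_card_le_card_Diff[of Bad "{..<M}"] finC by (simp add: V_def Bad_def)
  ultimately have cV: "M \<le> 2 * card V" using \<phi>(2) by linarith
  have "\<not> contains_copy G H"
  proof
    assume "contains_copy G H"
    then obtain f g where fg: "is_copy H G f g" by (auto simp: contains_copy_def)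
    define c where "c = (restrict f LS, restrict g RS)"
    have fU: "f ` LS \<subseteq> U" and gV: "g ` RS \<subseteq> V" and inj: "inj_on f LS" "inj_on g RS"
      and adj: "\<And>a b. (a, b) \<in> edges H \<Longrightarrow> (f a, g b) \<in> edges G"
      using fg by (auto simp: is_copy_def LS_def RS_def G_def)
    have "c \<in> C" using fU gV by (auto simp: c_def C_def V_def)
    moreover have "copy \<phi> c"
      unfolding copy_def
    proof (intro conjI ballI)
      show "inj_on (fst c) LS" "inj_on (snd c) RS" using inj by (simp_all add: c_def)
      fix b assume b: "b \<in> RS"
      obtain i j where [simp]: "b = (i, j)" by (cases b)
      have "(Inl i, (i, j)) \<in> edges H" "(Inr j, (i, j)) \<in> edges H" "Inl i \<in> LS" "Inr j \<in> LS"
        using b by (auto simp: H_def subdiv_def RS LS)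
      then show "case b of (i, j) \<Rightarrow> ok \<phi> (fst c (Inl i)) (snd c (i, j)) \<and> ok \<phi> (fst c (Inr j)) (snd c (i, j))"
        using adj[of "Inl i" "(i, j)"] adj[of "Inr j" "(i, j)"] b by (auto simp: c_def ok_def G_def)
    qed
    ultimately have "snd c (1, 1) \<in> Bad" by (auto simp: Bad_def)
    moreover have "(1, 1) \<in> RS" using pos by (simp add: RS)
    then have "snd c (1, 1) \<in> V" using gV by (auto simp: c_def)
    ultimately show False by (simp add: V_def)
  qed
  moreover have "finite_bigraph G"
    using finV \<phi>n by (auto simp: finite_bigraph_def G_def U_def V_def)
  moreover have "card (edges G) = d * card (right_side G)"
    by (auto simp: G_def card_image inj_on_def card_cartesian_product)
  ultimately show ?thesis using that[of G] cV by (simp add: G_def U_def H_def)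
qed

section \<open>Choice of parameters\<close>

lemma eventually_powr_ge:
  fixes \<kappa> K :: real
  assumes "\<kappa> > 0"
  shows "eventually (\<lambda>n. K \<le> real n powr \<kappa>) sequentially"
proof -
  have "K \<le> real n powr \<kappa>" if "max K 0 powr (1 / \<kappa>) \<le> real n" for n
  proof -
    have "max K 0 = (max K 0 powr (1 / \<kappa>)) powr \<kappa>" using assms by (simp add: powr_powr)
    also have "\<dots> \<le> real n powr \<kappa>" using that assms by (intro powr_mono2) auto
    finally show ?thesis by simp
  qed
  then show ?thesis
    using eventually_ge_at_top[of "nat \<lceil>max K 0 powr (1 / \<kappa>)\<rceil>"]
    by (elim eventually_mono) (simp add: nat_ceiling_le_eq)
qed

text \<open>The number \<open>\<kappa>\<close> is the surplus
  \<open>2 * s * t - (s + t) - \<rho> * (s * t - 1)\<close> of the exponent of \<open>n\<close> on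
  the right, after one factor \<open>M\<close> has been cancelled. It is written so that its
  dependence on \<open>t\<close> is visible.\<close>

lemma subdiv_counting_bound:
  fixes n d M s t :: nat and \<rho> \<kappa> :: real
  assumes n: "n > 0" and st: "s > 0" "t > 0" and M: "real M \<le> real n powr \<rho>"
    and \<kappa>: "\<kappa> = real t * ((2 - \<rho>) * real s - 1) - real s + \<rho>"
    and big: "2 * real d ^ (s + t) \<le> real n powr \<kappa>"
  shows "2 * ((d * n) ^ (s + t) * M ^ (s * t)) \<le> M * n ^ (2 * (s * t))"
proof -
  define k where "k = s * t - 1"
  have k: "s * t = Suc k" using st by (simp add: k_def)
  have rk: "real k = real s * real t - 1" using arg_cong[OF k, of real] by simp
  have "real M ^ k \<le> (real n powr \<rho>) ^ k" using M by (intro power_mono) auto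
  also have "\<dots> = real n powr (\<rho> * real k)" using n by (simp add: powr_power mult.commute)
  finally have Mk: "real M ^ k \<le> real n powr (\<rho> * real k)" .
  have pw: "real n ^ (s + t) = real n powr real (s + t)"
    using n by (intro powr_realpow[symmetric]) simp
  have "2 * (real d ^ (s + t) * real n ^ (s + t)) * real M ^ k
      = (2 * real d ^ (s + t)) * (real n ^ (s + t) * real M ^ k)" by simp
  also have "\<dots> \<le> real n powr \<kappa> * (real n ^ (s + t) * real n powr (\<rho> * real k))"
    using big Mk by (intro mult_mono) auto
  also have "\<dots> = real n powr (\<kappa> + (real (s + t) + \<rho> * real k))"
    unfolding pw by (simp only: powr_add)
  also have "\<kappa> + (real (s + t) + \<rho> * real k) = real (2 * (s * t))"
    unfolding \<kappa> rk by (simp add: algebra_simps)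
  also have "real n powr real (2 * (s * t)) = real n ^ (2 * (s * t))" using n by (intro powr_realpow) simp
  finally have "real M * (2 * (real d ^ (s + t) * real n ^ (s + t)) * real M ^ k)
      \<le> real M * real n ^ (2 * (s * t))" by (intro mult_left_mono) auto
  then have "real (2 * ((d * n) ^ (s + t) * M ^ Suc k)) \<le> real (M * n ^ (2 * (s * t)))"
    by (simp add: power_mult_distrib ac_simps)
  then show ?thesis unfolding of_nat_le_iff k .
qed

text \<open>The coefficient \<open>\<eta>\<close> of \<open>t\<close> in the surplus exponent
  \<open>\<kappa>\<close> is positive exactly when \<open>\<rho> < 2 - 1 / s\<close>, so
  \<open>\<kappa>\<close> is positive for large \<open>t\<close>. Taking \<open>\<rho>\<close>
  strictly above \<open>\<tau>\<close> leaves a power of \<open>n\<close> that absorbs the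
  dependence on \<open>d\<close>.\<close>

lemma not_linearly_forced_subdiv:
  fixes \<tau> :: real
  assumes s: "s > 0" and \<tau>: "0 < \<tau>" "\<tau> < 2 - 1 / real s"
  obtains t0 where "\<And>t. t \<ge> t0 \<Longrightarrow> \<not> linearly_forced (subdiv s t) \<tau>"
proof -
  obtain \<rho> where \<rho>: "\<tau> < \<rho>" "\<rho> < 2 - 1 / real s" using dense[OF \<tau>(2)] by blast
  define \<eta> where "\<eta> = (2 - \<rho>) * real s - 1"
  have "1 / real s < 2 - \<rho>" using \<rho>(2) by simp
  then have \<eta>: "\<eta> > 0" using s by (simp add: \<eta>_def pos_divide_less_eq)
  obtain t1 :: nat where t1: "real s / \<eta> \<le> real t1" using real_arch_simple by blast
  have "\<not> linearly_forced (subdiv s t) \<tau>" if t: "t \<ge> Suc t1" for t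
  proof
    assume forced: "linearly_forced (subdiv s t) \<tau>"
    have t0: "t > 0" using t by simp
    obtain \<delta> where \<delta>: "\<And>G :: (nat \<times> nat, nat) bigraph.
        finite_bigraph G \<Longrightarrow> left_side G \<noteq> {} \<or> right_side G \<noteq> {} \<Longrightarrow>
        real (card (right_side G)) \<ge> 1 * real (card (left_side G)) powr \<tau> \<Longrightarrow>
        real (card (edges G)) \<ge> \<delta> * real (card (right_side G)) \<Longrightarrow> contains_copy G (subdiv s t)"
      using linearly_forcedD[OF forced zero_less_one] by blast
    obtain d0 :: nat where "\<delta> \<le> real d0" using real_arch_simple by blast
    then have "\<exists>d. \<delta> \<le> real d \<and> d > 0" by (intro exI[of _ "Suc d0"]) auto
    then obtain d :: nat where d: "\<delta> \<le> real d" "d > 0" by blast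
    define \<kappa> where "\<kappa> = real t * ((2 - \<rho>) * real s - 1) - real s + \<rho>"
    have "real s / \<eta> \<le> real t" using t1 t by linarith
    then have "real s \<le> real t * \<eta>" using \<eta> by (simp add: pos_divide_le_eq)
    then have "\<kappa> > 0" using \<tau>(1) \<rho>(1) by (simp add: \<kappa>_def \<eta>_def)
    have "\<rho> > 0" "\<rho> - \<tau> > 0" using \<tau> \<rho> by auto
    have "eventually (\<lambda>n. n > 0 \<and> 2 * real d ^ (s + t) \<le> real n powr \<kappa> \<and> 1 \<le> real n powr \<rho> \<and>
        4 * real d powr \<tau> \<le> real n powr (\<rho> - \<tau>)) sequentially"
      by (intro eventually_conj eventually_powr_ge eventually_gt_at_top) fact+
    then obtain n :: nat where n: "n > 0" "2 * real d ^ (s + t) \<le> real n powr \<kappa>"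
        "1 \<le> real n powr \<rho>" "4 * real d powr \<tau> \<le> real n powr (\<rho> - \<tau>)"
      by (metis (mono_tags, lifting) eventually_sequentially order_refl)
    define M where "M = nat \<lfloor>real n powr \<rho>\<rfloor>"
    have M: "real M \<le> real n powr \<rho>" by (simp add: M_def)
    have M2: "real n powr \<rho> \<le> 2 * real M"
    proof -
      have "1 \<le> \<lfloor>real n powr \<rho>\<rfloor>" using n(3) by (simp add: le_floor_iff)
      then have "real M = of_int \<lfloor>real n powr \<rho>\<rfloor>" by (simp add: M_def)
      then show ?thesis using \<open>1 \<le> \<lfloor>real n powr \<rho>\<rfloor>\<close> by linarith
    qed
    obtain G :: "(nat \<times> nat, nat) bigraph" where G: "finite_bigraph G"
      "left_side G = {..<d} \<times> {..<n}" "M \<le> 2 * card (right_side G)"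
      "card (edges G) = d * card (right_side G)" "\<not> contains_copy G (subdiv s t)"
      using exists_subdiv_free[OF n(1) s t0 subdiv_counting_bound[OF n(1) s t0 M \<kappa>_def n(2)]]
      by blast
    have "contains_copy G (subdiv s t)"
    proof (rule \<delta>[OF G(1)])
      show "left_side G \<noteq> {} \<or> right_side G \<noteq> {}" using G(2) n(1) d(2) by auto
      \<comment> \<open>The factor 4 accounts for two losses of a factor 2, by rounding
        \<open>n powr \<rho>\<close> down to \<open>M\<close> and by deleting right
        vertices.\<close>
      have "4 * real (d * n) powr \<tau> = 4 * real d powr \<tau> * real n powr \<tau>"
        by (simp add: powr_mult)
      also have "\<dots> \<le> real n powr (\<rho> - \<tau>) * real n powr \<tau>"
        using n(4) by (intro mult_right_mono) auto
      also have "\<dots> = real n powr \<rho>" by (simp flip: powr_add)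
      also have "\<dots> \<le> 4 * real (card (right_side G))" using M2 G(3) by linarith
      finally show "real (card (right_side G)) \<ge> 1 * real (card (left_side G)) powr \<tau>"
        by (simp add: G(2) card_cartesian_product)
      show "real (card (edges G)) \<ge> \<delta> * real (card (right_side G))"
        using d(1) by (simp add: G(4) mult_right_mono)
    qed
    then show False using G(5) by simp
  qed
  then show ?thesis using that by blast
qed

theorem theorem1:
  "(\<forall>s t :: nat. s \<ge> 1 \<longrightarrow> t \<ge> 1 \<longrightarrow>
      linear_threshold (subdiv s t) \<le> ereal (2 - 1 / real s) \<and>
      linearly_forced (subdiv s t) (2 - 1 / real s)) \<and>
   (\<forall>(s :: nat) (\<sigma> :: real). s \<ge> 1 \<longrightarrow> \<sigma> < 2 - 1 / real s \<longrightarrow>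
      (\<exists>t0 :: nat. \<forall>t \<ge> t0. ereal \<sigma> < linear_threshold (subdiv s t)))"
proof (intro conjI allI impI)
  fix s t :: nat assume st: "s \<ge> 1" "t \<ge> 1"
  then show forced: "linearly_forced (subdiv s t) (2 - 1 / real s)"
    by (intro linearly_forced_subdiv) auto
  then show "linear_threshold (subdiv s t) \<le> ereal (2 - 1 / real s)"
    unfolding linear_threshold_def by (intro Inf_lower) simp
next
  fix s :: nat and \<sigma> :: real assume s: "s \<ge> 1" and \<sigma>: "\<sigma> < 2 - 1 / real s"
  \<comment> \<open>The construction needs a positive exponent, and \<open>2 - 1 / s\<close> is at
    least 1. A further \<open>\<tau>\<close> strictly above \<open>\<sigma>\<close> is inserted
    because the infimum is only bounded weakly, by \<open>\<tau>\<close>.\<close>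
  have "max \<sigma> 0 < 2 - 1 / real s" using s \<sigma> by (auto simp: field_simps)
  then obtain \<tau> where \<tau>: "max \<sigma> 0 < \<tau>" "\<tau> < 2 - 1 / real s" using dense by blast
  then obtain t0 where t0: "\<And>t. t \<ge> t0 \<Longrightarrow> \<not> linearly_forced (subdiv s t) \<tau>"
    using not_linearly_forced_subdiv[of s \<tau>] s by auto
  have "ereal \<sigma> < linear_threshold (subdiv s t)" if "t \<ge> t0" for t
  proof -
    have "ereal \<tau> \<le> linear_threshold (subdiv s t)"
      unfolding linear_threshold_def
    proof (intro Inf_greatest, elim imageE CollectE)
      fix x \<upsilon> assume "x = ereal \<upsilon>" "linearly_forced (subdiv s t) \<upsilon>"
      then show "ereal \<tau> \<le> x" using t0[OF that] linearly_forced_mono[of "subdiv s t" \<upsilon> \<tau>] by force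
    qed
    moreover have "ereal \<sigma> < ereal \<tau>" using \<tau>(1) by simp
    ultimately show ?thesis by (rule order_less_le_trans[rotated])
  qed
  then show "\<exists>t0. \<forall>t\<ge>t0. ereal \<sigma> < linear_threshold (subdiv s t)" by blast
qed

end
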